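(* There is a constant $C>0$ such that, whenever $\varphi:T^2\to[0,+\infty)$, $$\int_0^\infty\mathrm{Cap}\big(\{\zeta\in(\partial T)^2:\ \mathbb{I}\varphi(\zeta)>\lambda\}\big)\,d\lambda^2\le C\|\varphi\|^2_{\ell^2(T^2)},$$ where $d\lambda^2=2\lambda\,d\lambda$.
   Context: $T$ is (the vertex set of) the infinite rooted binary tree with root $o$; $\partial T$ is the set of infinite descending sequences $\omega=(\omega^j)_{j\ge0}$, $\omega^0=o$, $\omega^{j+1}$ a child of $\omega^j$; $\overline{T}=T\cup\partial T$. For $\alpha,\beta\in T$, $\alpha\le\beta$ means that $\beta$ lies on the path from $o$ to $\alpha$; also $\omega\le\omega^j$ for all $j$ and $\omega\le\omega$ when $\omega\in\partial T$. $T^2=T\times T$, $\overline{T}^2=\overline{T}\times\overline{T}$, $(\partial T)^2=\partial T\times\partial T$, with the product order. For $\varphi:T^2\to[0,\infty)$ and $\zeta\in\overline{T}^2$, $\mathbb{I}\varphi(\zeta)=\sum_{\alpha\in T^2,\ \alpha\ge\zeta}\varphi(\alpha)$. For $E\subseteq\overline{T}^2$, $\mathrm{Cap}(E)=\inf\{\|\varphi\|^2_{\ell^2(T^2)}:\varphi\ge0,\ \mathbb{I}\varphi(\zeta)\ge1\text{ for all }\zeta\in E\}$. *)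

theory Defs
  imports "HOL-Analysis.Analysis" "HOL-Library.Sublist"
begin

text \<open>A vertex of the rooted binary tree is the word of left/right choices leading to it from the
  root \<open>[]\<close>, so the vertices on the path from the root to \<open>\<alpha>\<close> are the prefixes of \<open>\<alpha>\<close>.\<close>

type_synonym vertex = "bool list"

definition is_child :: "vertex \<Rightarrow> vertex \<Rightarrow> bool" where
  "is_child \<beta> \<alpha> \<longleftrightarrow> (\<exists>b. \<beta> = \<alpha> @ [b])"

typedef ray = "{\<omega> :: nat \<Rightarrow> vertex. \<omega> 0 = [] \<and> (\<forall>j. is_child (\<omega> (Suc j)) (\<omega> j))}"
  morphisms ray_vertex Abs_ray
proof
  show "(\<lambda>j. replicate j True) \<in> {\<omega>. \<omega> 0 = [] \<and> (\<forall>j. is_child (\<omega> (Suc j)) (\<omega> j))}"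
    by (auto simp: is_child_def simp flip: replicate_append_same intro!: exI[of _ True])
qed

datatype point = Vertex vertex | Ray ray

fun tree_le :: "point \<Rightarrow> point \<Rightarrow> bool" where
  "tree_le (Vertex \<alpha>) (Vertex \<beta>) \<longleftrightarrow> prefix \<beta> \<alpha>"
| "tree_le (Ray \<omega>) (Vertex \<beta>) \<longleftrightarrow> (\<exists>j. \<beta> = ray_vertex \<omega> j)"
| "tree_le (Ray \<omega>) (Ray \<omega>') \<longleftrightarrow> \<omega> = \<omega>'"
| "tree_le (Vertex \<alpha>) (Ray \<omega>) \<longleftrightarrow> False"

definition bitree_le :: "point \<times> point \<Rightarrow> point \<times> point \<Rightarrow> bool" where
  "bitree_le \<zeta> \<xi> \<longleftrightarrow> tree_le (fst \<zeta>) (fst \<xi>) \<and> tree_le (snd \<zeta>) (snd \<xi>)"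

definition boundary :: "point set" where
  "boundary = range Ray"

text \<open>The sum may be infinite at points with a boundary component, hence the extended values.\<close>

definition potential :: "(vertex \<times> vertex \<Rightarrow> real) \<Rightarrow> point \<times> point \<Rightarrow> ennreal" where
  "potential \<phi> \<zeta> =
     (\<Sum>\<^sub>\<infinity>\<alpha>\<in>{\<alpha>. bitree_le \<zeta> (map_prod Vertex Vertex \<alpha>)}. ennreal (\<phi> \<alpha>))"

definition l2_norm_sq :: "(vertex \<times> vertex \<Rightarrow> real) \<Rightarrow> ennreal" where
  "l2_norm_sq \<phi> = (\<Sum>\<^sub>\<infinity>\<alpha>. ennreal ((\<phi> \<alpha>)\<^sup>2))"

definition Cap :: "(point \<times> point) set \<Rightarrow> ennreal" where
  "Cap E = Inf {l2_norm_sq \<phi> | \<phi>. (\<forall>\<alpha>. \<phi> \<alpha> \<ge> 0) \<and> (\<forall>\<zeta>\<in>E. potential \<phi> \<zeta> \<ge> 1)}"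

end

theory Submission imports Defs
begin

text \<open>The proof follows Hansson's duality argument for capacitary strong-type inequalities. Let \<open>E\<^sub>j\<close> be
the set where the potential of \<open>\<phi>\<close> exceeds \<open>a\<^sub>j\<close>, for levels \<open>a\<^sub>j\<close> in geometric progression, and let
\<open>\<mu>\<^sub>j\<close> be an equilibrium measure of \<open>E\<^sub>j\<close>: its potential \<open>I I* \<mu>\<^sub>j\<close> is at least \<open>1\<close> on \<open>E\<^sub>j\<close> and equal to
\<open>1\<close> on its support, so that its mass \<open>c\<^sub>j\<close> equals its energy and bounds the capacity of \<open>E\<^sub>j\<close>. Then

\<open>W = \<Sum> a\<^sub>j\<^sup>2 c\<^sub>j \<le> \<Sum> a\<^sub>j \<integral> I\<phi> d\<mu>\<^sub>j = \<langle>\<phi>, g\<rangle> \<le> \<parallel>\<phi>\<parallel> \<parallel>g\<parallel>\<close> with \<open>g = \<Sum> a\<^sub>j I* \<mu>\<^sub>j\<close>,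

and it suffices to show \<open>\<parallel>g\<parallel>\<^sup>2 \<le> C W\<close>. Expanding the square, this follows once the mutual energies
\<open>e\<^sub>j\<^sub>k = \<integral> I I* \<mu>\<^sub>k d\<mu>\<^sub>j\<close> are so small that \<open>a\<^sub>j a\<^sub>k e\<^sub>j\<^sub>k\<close>, compared with \<open>a\<^sub>j\<^sup>2 c\<^sub>j + a\<^sub>k\<^sup>2 c\<^sub>k\<close>, decays geometrically
in the distance of \<open>j\<close> and \<open>k\<close>.

On a single tree the maximum principle bounds \<open>I I* \<mu>\<^sub>k\<close> by \<open>1\<close>, and the growth of the levels does the rest.
On the bi-tree there is no such principle. The substitute, for equilibrium measures \<open>\<mu>\<close>, is the estimate
\<open>Cap {\<lambda> < I I* \<mu> \<le> 2 \<lambda>} \<le> C \<lambda>\<^sup>-\<^sup>3 \<parallel>I* \<mu>\<parallel>\<^sup>2\<close> for \<open>\<lambda> \<ge> 1\<close>. Chebyshev's inequality gives only the exponent \<open>2\<close>, which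
is exactly the borderline case; every exponent above \<open>2\<close> makes the double sum converge. The gain comes
from \<open>pot_square_le\<close>, a two-dimensional version of \<open>(I f)\<^sup>2 \<le> 2 I (f I f)\<close>, in which the cross term
\<open>I\<^sub>1 f I\<^sub>2 f\<close> appears, and from \<open>cross_energy_le\<close>, which bounds the energy of that cross term on
\<open>{I f \<le> M}\<close> by \<open>4 M \<parallel>f\<parallel>\<^sup>2\<close>. Together they provide (\<open>level_set_competitor\<close>) admissible functions for the
layers \<open>{\<lambda> < I f \<le> 2 \<lambda>}\<close>; summing over dyadic layers gives the bound on mutual energies
(\<open>mutual_energy_le\<close>).

All of this takes place at finite depth, where measures are finitely supported and equilibrium measures
exist by compactness. A general \<open>\<phi>\<close> in \<open>\<ell>\<^sup>2\<close> is a sum of functions of finite depth with rapidly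
decreasing norms, and countable subadditivity of the capacity (\<open>Cap_UN_le\<close>) puts the pieces together.\<close>

section \<open>Sums along one chain of ancestors\<close>

definition anc :: "vertex \<Rightarrow> vertex set" where
  "anc a = {p. prefix p a}"

lemma anc_Nil [simp]: "anc [] = {[]}"
  by (auto simp: anc_def)

lemma anc_snoc: "anc (a @ [c]) = insert (a @ [c]) (anc a)"
  by (auto simp: anc_def)

lemma finite_anc [simp]: "finite (anc a)"
  by (induction a rule: rev_induct) (auto simp: anc_snoc)

lemma snoc_notin_anc [simp]: "a @ [c] \<notin> anc a"
  by (auto simp: anc_def dest: prefix_length_le)

lemma self_in_anc [simp]: "a \<in> anc a"
  by (simp add: anc_def)

lemma anc_trans: "p \<in> anc q \<Longrightarrow> q \<in> anc a \<Longrightarrow> p \<in> anc a"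
  by (auto simp: anc_def)

lemma sum_anc_snoc: "sum g (anc (a @ [c])) = g (a @ [c]) + (\<Sum>p\<in>anc a. g p :: real)"
  by (simp add: anc_snoc)

text \<open>In a product of two sums along a chain, each pair of terms is charged to its lower vertex. For
\<open>g = h\<close> this is the one-parameter inequality \<open>(I g)\<^sup>2 \<le> 2 I (g I g)\<close>.\<close>

lemma chain_product_le:
  fixes g h :: "vertex \<Rightarrow> real"
  assumes "\<And>p. g p \<ge> 0" "\<And>p. h p \<ge> 0"
  shows "sum g (anc b) * sum h (anc b)
           \<le> (\<Sum>q\<in>anc b. g q * sum h (anc q) + h q * sum g (anc q))"
proof (induction b rule: rev_induct)
  case Nil
  show ?case using assms by simp
next
  case (snoc c b)
  have "0 \<le> g (b @ [c]) * h (b @ [c])"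
    using assms by simp
  then show ?case
    using snoc by (simp add: sum_anc_snoc algebra_simps)
qed

text \<open>The partial sums increase along the chain, so the vertices where they stay below \<open>M\<close> form an
initial segment, and the sum over that segment is itself one of these partial sums.\<close>

lemma chain_truncated_le:
  fixes g :: "vertex \<Rightarrow> real"
  assumes g: "\<And>p. g p \<ge> 0" and M: "M \<ge> 0"
  shows "(\<Sum>p\<in>{p\<in>anc a. sum g (anc p) \<le> M}. g p) \<le> M"
proof (induction a rule: rev_induct)
  case Nil
  have eq: "{p. p = [] \<and> g [] \<le> M} = (if g [] \<le> M then {[]} else {})"
    by auto
  have "(\<Sum>p\<in>{p. p = [] \<and> g [] \<le> M}. g p) \<le> M"
    unfolding eq using M by simp
  moreover have "{p \<in> anc []. sum g (anc p) \<le> M} = {p. p = [] \<and> g [] \<le> M}"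
    by auto
  ultimately show ?case by simp
next
  case (snoc c a)
  show ?case
  proof (cases "sum g (anc (a @ [c])) \<le> M")
    case True
    have "(\<Sum>p\<in>{p\<in>anc (a @ [c]). sum g (anc p) \<le> M}. g p) \<le> sum g (anc (a @ [c]))"
      by (intro sum_mono2) (auto simp: g)
    with True show ?thesis by simp
  next
    case False
    then have "{p\<in>anc (a @ [c]). sum g (anc p) \<le> M} = {p\<in>anc a. sum g (anc p) \<le> M}"
      by (auto simp: anc_snoc)
    with snoc show ?thesis by simp
  qed
qed

section \<open>The bi-tree potential and its square\<close>

text \<open>On vertices, the potential \<open>I f\<close> and the two one-parameter potentials \<open>I\<^sub>1 f\<close>, \<open>I\<^sub>2 f\<close>, in which only one
coordinate is summed. All three are finite sums, so they are kept real-valued.\<close>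

definition anc2 :: "vertex \<times> vertex \<Rightarrow> (vertex \<times> vertex) set" where
  "anc2 x = anc (fst x) \<times> anc (snd x)"

definition pot :: "(vertex \<times> vertex \<Rightarrow> real) \<Rightarrow> vertex \<times> vertex \<Rightarrow> real" where
  "pot f x = (\<Sum>\<alpha>\<in>anc2 x. f \<alpha>)"

definition pot1 :: "(vertex \<times> vertex \<Rightarrow> real) \<Rightarrow> vertex \<times> vertex \<Rightarrow> real" where
  "pot1 f x = (\<Sum>p\<in>anc (fst x). f (p, snd x))"

definition pot2 :: "(vertex \<times> vertex \<Rightarrow> real) \<Rightarrow> vertex \<times> vertex \<Rightarrow> real" where
  "pot2 f x = (\<Sum>q\<in>anc (snd x). f (fst x, q))"

lemma finite_anc2 [simp]: "finite (anc2 x)"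
  by (simp add: anc2_def)

lemma self_in_anc2 [simp]: "x \<in> anc2 x"
  by (simp add: anc2_def mem_Times_iff)

lemma anc2_mono: "\<alpha> \<in> anc2 x \<Longrightarrow> anc2 \<alpha> \<subseteq> anc2 x"
  by (auto simp: anc2_def intro: anc_trans)

lemma pot_nonneg: "(\<And>\<alpha>. f \<alpha> \<ge> 0) \<Longrightarrow> pot f x \<ge> 0"
  by (simp add: pot_def sum_nonneg)

lemma pot1_nonneg: "(\<And>\<alpha>. f \<alpha> \<ge> 0) \<Longrightarrow> pot1 f x \<ge> 0"
  by (simp add: pot1_def sum_nonneg)

lemma pot2_nonneg: "(\<And>\<alpha>. f \<alpha> \<ge> 0) \<Longrightarrow> pot2 f x \<ge> 0"
  by (simp add: pot2_def sum_nonneg)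

lemma pot_mono: "(\<And>\<alpha>. f \<alpha> \<ge> 0) \<Longrightarrow> \<alpha> \<in> anc2 x \<Longrightarrow> pot f \<alpha> \<le> pot f x"
  unfolding pot_def by (intro sum_mono2 anc2_mono) auto

lemma pot_eq_pot1_pot2: "pot f (a, b) = (\<Sum>p\<in>anc a. pot2 f (p, b))"
  by (simp add: pot_def pot2_def anc2_def sum.cartesian_product)

lemma pot_eq_pot2_pot1: "pot f (a, b) = (\<Sum>q\<in>anc b. pot1 f (a, q))"
  by (simp add: pot_eq_pot1_pot2 pot1_def pot2_def) (rule sum.swap)

lemma pot1_snoc: "pot1 f (a @ [c], b) = f (a @ [c], b) + pot1 f (a, b)"
  by (simp add: pot1_def sum_anc_snoc)

lemma pot_snoc: "pot f (a @ [c], b) = pot2 f (a @ [c], b) + pot f (a, b)"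
  by (simp add: pot_eq_pot1_pot2 sum_anc_snoc)

text \<open>Expanding the square gives a sum over pairs of ancestors of \<open>x\<close>. A comparable pair is charged to its
lower member and contributes to \<open>f I f\<close>; a crossing pair \<open>(p, q)\<close>, \<open>(p', q')\<close> with \<open>p\<close> below \<open>p'\<close> and \<open>q\<close>
above \<open>q'\<close> is charged to the common lower bound \<open>(p, q')\<close>, where it contributes to \<open>I\<^sub>1 f I\<^sub>2 f\<close>. The proof
organises this as an induction along the first coordinate with \<open>chain_product_le\<close> in the second.\<close>

lemma pot_square_le:
  assumes f: "\<And>\<alpha>. f \<alpha> \<ge> 0"
  shows "(pot f x)\<^sup>2 \<le> 2 * pot (\<lambda>\<alpha>. f \<alpha> * pot f \<alpha> + pot1 f \<alpha> * pot2 f \<alpha>) x"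
proof -
  let ?u = "\<lambda>\<alpha>. f \<alpha> * pot f \<alpha> + pot1 f \<alpha> * pot2 f \<alpha>"
  have sq: "(pot2 f (a, b))\<^sup>2 \<le> 2 * (\<Sum>q\<in>anc b. f (a, q) * pot2 f (a, q))" for a b
    using chain_product_le[of "\<lambda>q. f (a, q)" "\<lambda>q. f (a, q)" b] f
    by (simp add: pot2_def power2_eq_square sum_distrib_left)
  have cross: "pot f (a, b) * pot2 f (a', b)
      \<le> (\<Sum>q\<in>anc b. pot1 f (a, q) * pot2 f (a', q) + f (a', q) * pot f (a, q))" for a a' b
    using chain_product_le[of "\<lambda>q. pot1 f (a, q)" "\<lambda>q. f (a', q)" b] f pot1_nonneg[OF f]
    by (simp add: pot_eq_pot2_pot1 pot2_def)
  have "(pot f (a, b))\<^sup>2 \<le> 2 * pot ?u (a, b)" for a b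
  proof (induction a rule: rev_induct)
    case Nil
    have "pot f ([], b) = pot2 f ([], b)" for b
      by (simp add: pot_eq_pot1_pot2)
    moreover have "(\<Sum>q\<in>anc b. f ([], q) * pot2 f ([], q)) \<le> pot ?u ([], b)"
      unfolding pot_eq_pot1_pot2
      by (simp add: pot2_def[of ?u] calculation)
        (intro sum_mono, simp add: f pot1_nonneg pot2_nonneg)
    ultimately show ?case
      using sq[of "[]" b] by simp
  next
    case (snoc c a)
    let ?a = "a @ [c]"
    have "(pot f (?a, b))\<^sup>2 = (pot f (a, b))\<^sup>2 + (pot2 f (?a, b))\<^sup>2 + 2 * (pot f (a, b) * pot2 f (?a, b))"
      by (simp add: pot_snoc power2_eq_square algebra_simps)
    also have "\<dots> \<le> 2 * pot ?u (a, b) + 2 * (\<Sum>q\<in>anc b. f (?a, q) * pot2 f (?a, q))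
        + 2 * (\<Sum>q\<in>anc b. pot1 f (a, q) * pot2 f (?a, q) + f (?a, q) * pot f (a, q))"
      using snoc sq[of ?a b] cross[of a b ?a] by linarith
    also have "\<dots> = 2 * pot ?u (a, b)
        + 2 * (\<Sum>q\<in>anc b. f (?a, q) * pot2 f (?a, q) + pot1 f (a, q) * pot2 f (?a, q)
                 + f (?a, q) * pot f (a, q))"
      by (simp add: sum.distrib)
    also have "\<dots> \<le> 2 * pot ?u (a, b) + 2 * pot2 ?u (?a, b)"
    proof -
      have "(\<Sum>q\<in>anc b. f (?a, q) * pot2 f (?a, q) + pot1 f (a, q) * pot2 f (?a, q)
                 + f (?a, q) * pot f (a, q)) \<le> pot2 ?u (?a, b)"
        unfolding pot2_def[of ?u] fst_conv snd_conv
        by (intro sum_mono) (simp add: pot_snoc pot1_snoc algebra_simps f pot2_nonneg)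
      then show ?thesis by simp
    qed
    also have "\<dots> = 2 * pot ?u (?a, b)"
      by (simp add: pot_snoc[of ?u])
    finally show ?case .
  qed
  then show ?thesis
    by (cases x) simp
qed

section \<open>Measures on the finite bi-tree\<close>

text \<open>\<open>copot X \<mu>\<close> is the adjoint potential \<open>I* \<mu>\<close> of the measure with weights \<open>\<mu>\<close> on the set of points \<open>X\<close>:
the mass lying below a vertex.\<close>

definition copot :: "(vertex \<times> vertex) set \<Rightarrow> (vertex \<times> vertex \<Rightarrow> real) \<Rightarrow> vertex \<times> vertex \<Rightarrow> real" where
  "copot X \<mu> \<alpha> = (\<Sum>x | x \<in> X \<and> \<alpha> \<in> anc2 x. \<mu> x)"

definition words :: "nat \<Rightarrow> vertex set" where
  "words N = {a. length a \<le> N}"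

definition bitree :: "nat \<Rightarrow> (vertex \<times> vertex) set" where
  "bitree N = words N \<times> words N"

lemma finite_words [simp]: "finite (words N)"
  using finite_lists_length_le[of "UNIV :: bool set" N] by (simp add: words_def)

lemma finite_bitree [simp]: "finite (bitree N)"
  by (simp add: bitree_def)

lemma anc_words: "p \<in> anc a \<Longrightarrow> a \<in> words N \<Longrightarrow> p \<in> words N"
  by (auto simp: anc_def words_def dest: prefix_length_le)

lemma anc2_subset_bitree: "x \<in> bitree N \<Longrightarrow> anc2 x \<subseteq> bitree N"
  by (auto simp: anc2_def bitree_def intro: anc_words)

lemma copot_nonneg: "(\<And>x. \<mu> x \<ge> 0) \<Longrightarrow> copot X \<mu> \<alpha> \<ge> 0"
  by (simp add: copot_def sum_nonneg)

lemma sum_mult_copot: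
  assumes X: "X \<subseteq> bitree N"
  shows "(\<Sum>\<alpha>\<in>bitree N. \<phi> \<alpha> * copot X \<mu> \<alpha>) = (\<Sum>x\<in>X. \<mu> x * pot \<phi> x)"
proof -
  have fin: "finite X"
    using X finite_bitree by (rule finite_subset)
  have "(\<Sum>\<alpha>\<in>bitree N. \<phi> \<alpha> * copot X \<mu> \<alpha>)
      = (\<Sum>\<alpha>\<in>bitree N. \<Sum>x | x \<in> X \<and> \<alpha> \<in> anc2 x. \<phi> \<alpha> * \<mu> x)"
    by (simp add: copot_def sum_distrib_left)
  also have "\<dots> = (\<Sum>x\<in>X. \<Sum>\<alpha> | \<alpha> \<in> bitree N \<and> \<alpha> \<in> anc2 x. \<phi> \<alpha> * \<mu> x)"
    by (rule sum.swap_restrict) (simp_all add: fin)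
  also have "\<dots> = (\<Sum>x\<in>X. \<Sum>\<alpha>\<in>anc2 x. \<phi> \<alpha> * \<mu> x)"
    using X anc2_subset_bitree by (intro sum.cong) blast+
  also have "\<dots> = (\<Sum>x\<in>X. \<mu> x * pot \<phi> x)"
    by (simp add: pot_def sum_distrib_left mult.commute)
  finally show ?thesis .
qed

text \<open>The one-parameter energy of a measure of which \<open>g\<close> is the adjoint potential, cut off where the potential exceeds \<open>M\<close>. One
factor \<open>g a\<close> is written as the mass below \<open>a\<close>; then each unit of mass below \<open>p\<close> sees a truncated chain
sum, which is at most \<open>M\<close> by \<open>chain_truncated_le\<close>.\<close>

lemma truncated_energy_le:
  fixes w :: "'i \<Rightarrow> real" and z :: "'i \<Rightarrow> vertex"
  assumes fin: "finite I" "finite A" and w: "\<And>i. w i \<ge> 0" and M: "M \<ge> 0"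
    and g: "\<And>a. g a = (\<Sum>i | i \<in> I \<and> a \<in> anc (z i). w i)"
  shows "(\<Sum>a | a \<in> A \<and> p \<in> anc a \<and> sum g (anc a) \<le> M. (g a)\<^sup>2) \<le> M * g p"
proof -
  define A' where "A' = {a. a \<in> A \<and> p \<in> anc a \<and> sum g (anc a) \<le> M}"
  have fin': "finite A'"
    using fin by (simp add: A'_def)
  have g0: "g a \<ge> 0" for a
    unfolding g by (simp add: w sum_nonneg)
  have "(\<Sum>a\<in>A'. (g a)\<^sup>2) = (\<Sum>a\<in>A'. \<Sum>i | i \<in> I \<and> a \<in> anc (z i). g a * w i)"
    by (simp add: power2_eq_square sum_distrib_left[symmetric] g[symmetric])
  also have "\<dots> = (\<Sum>i\<in>I. \<Sum>a | a \<in> A' \<and> a \<in> anc (z i). g a * w i)"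
    by (rule sum.swap_restrict) (simp_all add: fin fin')
  also have "\<dots> \<le> (\<Sum>i\<in>I. if p \<in> anc (z i) then M * w i else 0)"
  proof (rule sum_mono)
    fix i
    show "(\<Sum>a | a \<in> A' \<and> a \<in> anc (z i). g a * w i) \<le> (if p \<in> anc (z i) then M * w i else 0)"
    proof (cases "p \<in> anc (z i)")
      case True
      have "(\<Sum>a | a \<in> A' \<and> a \<in> anc (z i). g a) \<le> (\<Sum>a\<in>{a\<in>anc (z i). sum g (anc a) \<le> M}. g a)"
        by (intro sum_mono2) (auto simp: A'_def g0)
      also have "\<dots> \<le> M"
        using g0 M by (rule chain_truncated_le)
      finally have "(\<Sum>a | a \<in> A' \<and> a \<in> anc (z i). g a) \<le> M" .
      then show ?thesis
        using True w[of i] by (simp add: sum_distrib_right[symmetric] mult_right_mono)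
    next
      case False
      then have empty: "{a. a \<in> A' \<and> a \<in> anc (z i)} = {}"
        by (auto simp: A'_def dest: anc_trans)
      show ?thesis
        unfolding empty using False by simp
    qed
  qed
  also have "\<dots> = M * g p"
    by (simp add: g sum_distrib_left sum.If_cases fin Int_def)
  finally show ?thesis
    by (simp add: A'_def)
qed

text \<open>For a fixed second coordinate, summing \<open>I* \<mu>\<close> over that coordinate yields again the adjoint potential of a
measure on one tree. This is what makes \<open>truncated_energy_le\<close> applicable to columns.\<close>

lemma pot2_copot:
  assumes "finite X"
  shows "pot2 (copot X \<mu>) (a, b)
           = (\<Sum>x | x \<in> X \<and> a \<in> anc (fst x). \<mu> x * real (card (anc b \<inter> anc (snd x))))"
proof -
  have "pot2 (copot X \<mu>) (a, b) = (\<Sum>x\<in>X. \<Sum>q | q \<in> anc b \<and> (a, q) \<in> anc2 x. \<mu> x)"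
    unfolding pot2_def copot_def fst_conv snd_conv
    by (rule sum.swap_restrict) (simp_all add: assms)
  also have "\<dots> = (\<Sum>x\<in>X. if a \<in> anc (fst x) then \<mu> x * real (card (anc b \<inter> anc (snd x))) else 0)"
    by (intro sum.cong) (auto simp: anc2_def Int_def)
  also have "\<dots> = (\<Sum>x | x \<in> X \<and> a \<in> anc (fst x). \<mu> x * real (card (anc b \<inter> anc (snd x))))"
    by (simp add: sum.If_cases assms Int_def)
  finally show ?thesis .
qed

lemma column_energy_le:
  assumes fin: "finite X" "finite A" and \<mu>: "\<And>x. \<mu> x \<ge> 0" and M: "M \<ge> 0"
  shows "(\<Sum>a | a \<in> A \<and> p \<in> anc a \<and> pot (copot X \<mu>) (a, b) \<le> M. (pot2 (copot X \<mu>) (a, b))\<^sup>2)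
           \<le> M * pot2 (copot X \<mu>) (p, b)"
  unfolding pot_eq_pot1_pot2
  by (rule truncated_energy_le[where I = X and z = fst
        and w = "\<lambda>x. \<mu> x * real (card (anc b \<inter> anc (snd x)))"])
    (simp_all add: fin \<mu> M pot2_copot)

section \<open>Energy of the cross term\<close>

lemma pot1_square_le:
  assumes f: "\<And>\<alpha>. f \<alpha> \<ge> 0"
  shows "(pot1 f (a, b))\<^sup>2 \<le> 2 * (\<Sum>p\<in>anc a. f (p, b) * pot1 f (p, b))"
  using chain_product_le[of "\<lambda>p. f (p, b)" "\<lambda>p. f (p, b)" a] f
  by (simp add: pot1_def power2_eq_square sum_distrib_left)

lemma sum_bitree_Collect:
  "(\<Sum>\<alpha> | \<alpha> \<in> bitree N \<and> P \<alpha>. h \<alpha>) = (\<Sum>b\<in>words N. \<Sum>a | a \<in> words N \<and> P (a, b). h (a, b))"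
proof -
  have "(\<Sum>\<alpha> | \<alpha> \<in> bitree N \<and> P \<alpha>. h \<alpha>) = (\<Sum>\<alpha>\<in>bitree N. if P \<alpha> then h \<alpha> else 0)"
    by (simp add: sum.If_cases Int_def)
  also have "\<dots> = (\<Sum>a\<in>words N. \<Sum>b\<in>words N. if P (a, b) then h (a, b) else 0)"
    unfolding bitree_def by (simp add: sum.cartesian_product)
  also have "\<dots> = (\<Sum>b\<in>words N. \<Sum>a\<in>words N. if P (a, b) then h (a, b) else 0)"
    by (rule sum.swap)
  also have "\<dots> = (\<Sum>b\<in>words N. \<Sum>a | a \<in> words N \<and> P (a, b). h (a, b))"
    by (simp add: sum.If_cases Int_def)
  finally show ?thesis .
qed

text \<open>The square of \<open>I\<^sub>1 f\<close> is opened up by the one-parameter inequality; after exchanging sums, the square of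
\<open>I\<^sub>2 f\<close> is left to be summed over the first coordinate below a given vertex and over \<open>{I f \<le> M}\<close>. Since
\<open>I f = I\<^sub>1 (I\<^sub>2 f)\<close>, that inner sum is a truncated energy and costs a factor \<open>M\<close>.\<close>

lemma cross_energy_le_triple:
  fixes \<mu> :: "vertex \<times> vertex \<Rightarrow> real"
  assumes fin: "finite X" and \<mu>: "\<And>x. \<mu> x \<ge> 0" and M: "M \<ge> 0"
  defines "f \<equiv> copot X \<mu>"
  shows "(\<Sum>\<alpha> | \<alpha> \<in> bitree N \<and> pot f \<alpha> \<le> M. (pot1 f \<alpha> * pot2 f \<alpha>)\<^sup>2)
           \<le> 2 * M * (\<Sum>\<alpha>\<in>bitree N. f \<alpha> * pot1 f \<alpha> * pot2 f \<alpha>)"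
proof -
  have f: "f \<alpha> \<ge> 0" for \<alpha>
    unfolding f_def using \<mu> by (rule copot_nonneg)
  have row: "(\<Sum>a | a \<in> words N \<and> pot f (a, b) \<le> M. (pot1 f (a, b) * pot2 f (a, b))\<^sup>2)
      \<le> 2 * M * (\<Sum>p\<in>words N. f (p, b) * pot1 f (p, b) * pot2 f (p, b))" for b
  proof -
    define A where "A = {a. a \<in> words N \<and> pot f (a, b) \<le> M}"
    have finA: "finite A" by (simp add: A_def)
    have "(\<Sum>a\<in>A. (pot1 f (a, b) * pot2 f (a, b))\<^sup>2)
        \<le> (\<Sum>a\<in>A. \<Sum>p\<in>anc a. 2 * (f (p, b) * pot1 f (p, b)) * (pot2 f (a, b))\<^sup>2)"
      using mult_right_mono[OF pot1_square_le[OF f] zero_le_power2]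
      by (intro sum_mono) (simp add: power_mult_distrib sum_distrib_left sum_distrib_right)
    also have "\<dots> = (\<Sum>a\<in>A. \<Sum>p | p \<in> words N \<and> p \<in> anc a.
                        2 * (f (p, b) * pot1 f (p, b)) * (pot2 f (a, b))\<^sup>2)"
      by (intro sum.cong refl) (auto simp: A_def intro: anc_words)
    also have "\<dots> = (\<Sum>p\<in>words N. \<Sum>a | a \<in> A \<and> p \<in> anc a.
                        2 * (f (p, b) * pot1 f (p, b)) * (pot2 f (a, b))\<^sup>2)"
      by (rule sum.swap_restrict) (simp_all add: finA)
    also have "\<dots> \<le> (\<Sum>p\<in>words N. 2 * (f (p, b) * pot1 f (p, b)) * (M * pot2 f (p, b)))"
    proof (rule sum_mono)
      fix p
      have "{a. a \<in> A \<and> p \<in> anc a} = {a. a \<in> words N \<and> p \<in> anc a \<and> pot f (a, b) \<le> M}"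
        by (auto simp: A_def)
      then have "(\<Sum>a | a \<in> A \<and> p \<in> anc a. (pot2 f (a, b))\<^sup>2) \<le> M * pot2 f (p, b)"
        unfolding f_def using column_energy_le[of X "words N" \<mu> M b p, OF fin finite_words \<mu> M] by simp
      then show "(\<Sum>a | a \<in> A \<and> p \<in> anc a. 2 * (f (p, b) * pot1 f (p, b)) * (pot2 f (a, b))\<^sup>2)
          \<le> 2 * (f (p, b) * pot1 f (p, b)) * (M * pot2 f (p, b))"
        unfolding sum_distrib_left[symmetric]
        by (intro mult_left_mono) (simp_all add: f pot1_nonneg)
    qed
    also have "\<dots> = 2 * M * (\<Sum>p\<in>words N. f (p, b) * pot1 f (p, b) * pot2 f (p, b))"
      by (simp add: sum_distrib_left mult_ac)
    finally show ?thesis by (simp add: A_def)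
  qed
  have "(\<Sum>\<alpha> | \<alpha> \<in> bitree N \<and> pot f \<alpha> \<le> M. (pot1 f \<alpha> * pot2 f \<alpha>)\<^sup>2)
      \<le> (\<Sum>b\<in>words N. 2 * M * (\<Sum>p\<in>words N. f (p, b) * pot1 f (p, b) * pot2 f (p, b)))"
    unfolding sum_bitree_Collect by (intro sum_mono row)
  also have "\<dots> = 2 * M * (\<Sum>\<alpha>\<in>bitree N. f \<alpha> * pot1 f \<alpha> * pot2 f \<alpha>)"
    using sum_bitree_Collect[where N = N and P = "\<lambda>_. True" and h = "\<lambda>\<alpha>. f \<alpha> * pot1 f \<alpha> * pot2 f \<alpha>"]
    by (simp add: sum_distrib_left)
  finally show ?thesis .
qed

text \<open>Potentials increase downwards and \<open>f = I* \<mu>\<close> lives above the support of \<open>\<mu>\<close>, so \<open>I f \<le> 1\<close> wherever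
\<open>f \<noteq> 0\<close>. Hence the triple sum \<open>\<Sum> f I\<^sub>1 f I\<^sub>2 f\<close> only involves the cross term on \<open>{I f \<le> 1}\<close>, whose energy
is controlled by the same triple sum (the case \<open>M = 1\<close> of the preceding lemma). This self-improvement
bounds the triple sum by \<open>2 \<parallel>f\<parallel>\<^sup>2\<close>, and the preceding lemma for general \<open>M\<close> concludes.\<close>

lemma cross_energy_le:
  fixes \<mu> :: "vertex \<times> vertex \<Rightarrow> real"
  assumes fin: "finite X" and \<mu>: "\<And>x. \<mu> x \<ge> 0" and M: "M \<ge> 0"
  defines "f \<equiv> copot X \<mu>"
  assumes le1: "\<And>x. x \<in> X \<Longrightarrow> \<mu> x > 0 \<Longrightarrow> pot f x \<le> 1"
  shows "(\<Sum>\<alpha> | \<alpha> \<in> bitree N \<and> pot f \<alpha> \<le> M. (pot1 f \<alpha> * pot2 f \<alpha>)\<^sup>2)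
           \<le> 4 * M * (\<Sum>\<alpha>\<in>bitree N. (f \<alpha>)\<^sup>2)"
    and "f \<alpha> > 0 \<Longrightarrow> pot f \<alpha> \<le> 1"
proof -
  let ?A = "\<lambda>M. \<Sum>\<alpha> | \<alpha> \<in> bitree N \<and> pot f \<alpha> \<le> M. (pot1 f \<alpha> * pot2 f \<alpha>)\<^sup>2"
  let ?E = "\<Sum>\<alpha>\<in>bitree N. (f \<alpha>)\<^sup>2"
  let ?T = "\<Sum>\<alpha>\<in>bitree N. f \<alpha> * pot1 f \<alpha> * pot2 f \<alpha>"
  have f: "f \<alpha> \<ge> 0" for \<alpha>
    unfolding f_def using \<mu> by (rule copot_nonneg)
  show supp: "pot f \<alpha> \<le> 1" if "f \<alpha> > 0" for \<alpha>
  proof -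
    have "\<exists>x\<in>X. \<alpha> \<in> anc2 x \<and> \<mu> x > 0"
    proof (rule ccontr)
      assume "\<not> ?thesis"
      then have "f \<alpha> \<le> 0"
        unfolding f_def copot_def by (intro sum_nonpos) force
      with \<open>f \<alpha> > 0\<close> show False by simp
    qed
    then obtain x where x: "x \<in> X" "\<alpha> \<in> anc2 x" "\<mu> x > 0"
      by blast
    show ?thesis
      using pot_mono[of f, OF f x(2)] le1[OF x(1,3)] by simp
  qed
  \<comment> \<open>The weights in this Young inequality leave half of the triple sum to be absorbed.\<close>
  have "?T \<le> (\<Sum>\<alpha>\<in>bitree N. (f \<alpha>)\<^sup>2 + (if pot f \<alpha> \<le> 1 then (pot1 f \<alpha> * pot2 f \<alpha>)\<^sup>2 / 4 else 0))"
  proof (rule sum_mono)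
    fix \<alpha>
    show "f \<alpha> * pot1 f \<alpha> * pot2 f \<alpha>
        \<le> (f \<alpha>)\<^sup>2 + (if pot f \<alpha> \<le> 1 then (pot1 f \<alpha> * pot2 f \<alpha>)\<^sup>2 / 4 else 0)"
    proof (cases "f \<alpha> = 0")
      case False
      then have "pot f \<alpha> \<le> 1"
        using supp[of \<alpha>] f[of \<alpha>] by simp
      moreover have "0 \<le> (f \<alpha> - pot1 f \<alpha> * pot2 f \<alpha> / 2)\<^sup>2"
        by simp
      ultimately show ?thesis
        by (simp add: power2_eq_square algebra_simps)
    qed simp
  qed
  also have "\<dots> = ?E + ?A 1 / 4"
    by (simp add: sum.distrib sum.If_cases Int_def sum_divide_distrib)
  finally have T: "?T \<le> ?E + ?A 1 / 4" .
  have "?A 1 \<le> 2 * ?T"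
    using cross_energy_le_triple[where X = X and \<mu> = \<mu> and M = 1 and N = N, OF fin \<mu>] by (simp add: f_def)
  with T have "?T \<le> 2 * ?E"
    by linarith
  then have "2 * M * ?T \<le> 2 * M * (2 * ?E)"
    using M by (intro mult_left_mono) simp_all
  then show "?A M \<le> 4 * M * ?E"
    using cross_energy_le_triple[where X = X and \<mu> = \<mu> and M = M and N = N, OF fin \<mu> M] by (simp add: f_def)
qed

text \<open>The admissible function is \<open>(2 / l\<^sup>2) (f I f + I\<^sub>1 f I\<^sub>2 f)\<close>, cut off to \<open>{I f \<le> 2 l}\<close>; the cut-off does
not affect its potential at points of that set, whose ancestors all belong to it. By \<open>pot_square_le\<close> this
potential is at least \<open>(I f)\<^sup>2 / l\<^sup>2\<close>. The factor \<open>l\<^sup>-\<^sup>3\<close> arises as \<open>l\<^sup>-\<^sup>4\<close> from the normalisation times \<open>l\<close> from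
the energy of the cross term.\<close>

lemma level_set_competitor:
  fixes \<mu> :: "vertex \<times> vertex \<Rightarrow> real"
  assumes fin: "finite X" and \<mu>: "\<And>x. \<mu> x \<ge> 0" and l: "l \<ge> 1"
  defines "f \<equiv> copot X \<mu>"
  assumes le1: "\<And>x. x \<in> X \<Longrightarrow> \<mu> x > 0 \<Longrightarrow> pot f x \<le> 1"
  obtains \<psi> where "\<And>\<alpha>. \<psi> \<alpha> \<ge> 0"
    and "\<And>x. l < pot f x \<Longrightarrow> pot f x \<le> 2 * l \<Longrightarrow> pot \<psi> x \<ge> 1"
    and "(\<Sum>\<alpha>\<in>bitree N. (\<psi> \<alpha>)\<^sup>2) \<le> 72 / l ^ 3 * (\<Sum>\<alpha>\<in>bitree N. (f \<alpha>)\<^sup>2)"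
proof
  define u where "u \<alpha> = f \<alpha> * pot f \<alpha> + pot1 f \<alpha> * pot2 f \<alpha>" for \<alpha>
  define \<psi> where "\<psi> \<alpha> = (if pot f \<alpha> \<le> 2 * l then 2 / l\<^sup>2 * u \<alpha> else 0)" for \<alpha>
  have f: "f \<alpha> \<ge> 0" for \<alpha>
    unfolding f_def using \<mu> by (rule copot_nonneg)
  have u: "u \<alpha> \<ge> 0" for \<alpha>
    by (simp add: u_def f pot_nonneg pot1_nonneg pot2_nonneg)
  show "\<psi> \<alpha> \<ge> 0" for \<alpha>
    by (simp add: \<psi>_def u)
  show "pot \<psi> x \<ge> 1" if x: "l < pot f x" "pot f x \<le> 2 * l" for x
  proof -
    have "pot \<psi> x = pot (\<lambda>\<alpha>. 2 / l\<^sup>2 * u \<alpha>) x"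
      unfolding pot_def
    proof (rule sum.cong)
      fix \<alpha> assume "\<alpha> \<in> anc2 x"
      then have "pot f \<alpha> \<le> 2 * l"
        using pot_mono[of f \<alpha> x, OF f] x(2) by fastforce
      then show "\<psi> \<alpha> = 2 / l\<^sup>2 * u \<alpha>"
        by (simp add: \<psi>_def)
    qed simp
    also have "\<dots> = 2 * pot u x / l\<^sup>2"
      by (simp add: pot_def sum_distrib_left sum_divide_distrib)
    finally have eq: "pot \<psi> x = 2 * pot u x / l\<^sup>2" .
    have "l\<^sup>2 \<le> (pot f x)\<^sup>2"
      using x l by (intro power_mono) simp_all
    also have "\<dots> \<le> 2 * pot u x"
      unfolding u_def using f by (rule pot_square_le)
    finally show ?thesis
      unfolding eq using l by (simp add: le_divide_eq)
  qed
  let ?E = "\<Sum>\<alpha>\<in>bitree N. (f \<alpha>)\<^sup>2"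
  let ?c = "\<lambda>\<alpha>. pot1 f \<alpha> * pot2 f \<alpha>"
  have E: "?E \<ge> 0" by (simp add: sum_nonneg)
  have "(\<Sum>\<alpha>\<in>bitree N. (\<psi> \<alpha>)\<^sup>2)
      \<le> (\<Sum>\<alpha>\<in>bitree N. 8 / l ^ 4 * ((f \<alpha>)\<^sup>2 + (if pot f \<alpha> \<le> 2 * l then (?c \<alpha>)\<^sup>2 else 0)))"
  proof (rule sum_mono)
    fix \<alpha>
    have fp: "(f \<alpha> * pot f \<alpha>)\<^sup>2 \<le> (f \<alpha>)\<^sup>2"
    proof (cases "f \<alpha> = 0")
      case False
      then have "pot f \<alpha> \<le> 1"
        using cross_energy_le(2)[where X = X and \<mu> = \<mu> and M = 1 and \<alpha> = \<alpha>, OF fin \<mu>] le1 f[of \<alpha>] by (simp add: f_def)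
      then have "(pot f \<alpha>)\<^sup>2 \<le> 1"
        using pot_nonneg[OF f] by (simp add: power_le_one)
      then show ?thesis
        by (simp add: power_mult_distrib mult_left_le)
    qed simp
    have "(u \<alpha>)\<^sup>2 \<le> 2 * (f \<alpha> * pot f \<alpha>)\<^sup>2 + 2 * (?c \<alpha>)\<^sup>2"
      using sum_squares_bound[of "f \<alpha> * pot f \<alpha>" "?c \<alpha>"] by (simp add: u_def power2_sum)
    with fp have "(u \<alpha>)\<^sup>2 \<le> 2 * ((f \<alpha>)\<^sup>2 + (?c \<alpha>)\<^sup>2)"
      by argo
    then have "4 / l ^ 4 * (u \<alpha>)\<^sup>2 \<le> 4 / l ^ 4 * (2 * ((f \<alpha>)\<^sup>2 + (?c \<alpha>)\<^sup>2))"
      using l by (intro mult_left_mono) simp_all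
    moreover have "(2 / l\<^sup>2 * u \<alpha>)\<^sup>2 = 4 / l ^ 4 * (u \<alpha>)\<^sup>2"
      by (simp add: power_mult_distrib power_divide flip: power_mult)
    ultimately show "(\<psi> \<alpha>)\<^sup>2 \<le> 8 / l ^ 4 * ((f \<alpha>)\<^sup>2 + (if pot f \<alpha> \<le> 2 * l then (?c \<alpha>)\<^sup>2 else 0))"
      by (simp add: \<psi>_def)
  qed
  also have "\<dots> = 8 / l ^ 4 * (?E + (\<Sum>\<alpha> | \<alpha> \<in> bitree N \<and> pot f \<alpha> \<le> 2 * l. (?c \<alpha>)\<^sup>2))"
    unfolding sum_distrib_left[symmetric] by (simp add: sum.distrib sum.If_cases Int_def)
  also have "\<dots> \<le> 8 / l ^ 4 * (?E + 4 * (2 * l) * ?E)"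
    using cross_energy_le(1)[where X = X and \<mu> = \<mu> and M = "2 * l" and N = N, OF fin \<mu>] le1 l
    by (intro mult_left_mono add_left_mono) (simp_all add: f_def)
  also have "\<dots> \<le> 8 / l ^ 4 * (9 * l * ?E)"
    using mult_right_mono[OF l E] l by (intro mult_left_mono) simp_all
  also have "\<dots> = 72 / l ^ 3 * ?E"
    using l by (simp add: field_simps eval_nat_numeral)
  finally show "(\<Sum>\<alpha>\<in>bitree N. (\<psi> \<alpha>)\<^sup>2) \<le> 72 / l ^ 3 * ?E" .
qed

section \<open>Equilibrium measures\<close>

text \<open>The weights maximise the dual functional \<open>2 \<Sum> \<mu> - \<Sum> \<mu> K \<mu>\<close>, and the conclusions are its first-order
conditions. Maximising over the compact box \<open>[0, 2]\<^sup>A\<close> instead of the whole cone is harmless: as the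
diagonal of \<open>K\<close> is at least \<open>1\<close>, a coordinate at which increasing the weight is profitable is below \<open>1\<close>,
so its upper bound is never active.\<close>

lemma complementary_weights_exist:
  fixes K :: "'i \<Rightarrow> 'i \<Rightarrow> real"
  assumes fin: "finite A"
    and sym: "\<And>x y. K x y = K y x" and nonneg: "\<And>x y. K x y \<ge> 0" and diag: "\<And>x. K x x \<ge> 1"
  obtains \<mu> where "\<And>x. \<mu> x \<ge> 0"
    and "\<And>x. x \<in> A \<Longrightarrow> (\<Sum>y\<in>A. K x y * \<mu> y) \<ge> 1"
    and "\<And>x. x \<in> A \<Longrightarrow> \<mu> x > 0 \<Longrightarrow> (\<Sum>y\<in>A. K x y * \<mu> y) = 1"
proof -
  define S where "S = PiE UNIV (\<lambda>x. if x \<in> A then {0..2::real} else {0})"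
  define V where "V \<mu> x = (\<Sum>y\<in>A. K x y * \<mu> y)" for \<mu> x
  define J where "J \<mu> = 2 * (\<Sum>x\<in>A. \<mu> x) - (\<Sum>x\<in>A. \<mu> x * V \<mu> x)" for \<mu>
  have S_iff: "\<mu> \<in> S \<longleftrightarrow> (\<forall>x. if x \<in> A then 0 \<le> \<mu> x \<and> \<mu> x \<le> 2 else \<mu> x = 0)" for \<mu>
    by (auto simp: S_def PiE_iff split: if_splits)
  have "compactin (product_topology (\<lambda>_. euclidean) UNIV) S"
    unfolding S_def compactin_PiE by auto
  then have "compact S"
    by (simp add: euclidean_product_topology)
  moreover have "(\<lambda>_. 0) \<in> S"
    by (simp add: S_iff)
  then have "S \<noteq> {}" by blast
  moreover have "continuous_on S J"
    unfolding J_def V_def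
    by (intro continuous_intros continuous_on_product_then_coordinatewise continuous_on_id)
  ultimately obtain \<mu> where \<mu>: "\<mu> \<in> S" and max: "\<And>\<nu>. \<nu> \<in> S \<Longrightarrow> J \<nu> \<le> J \<mu>"
    by (meson continuous_attains_sup)
  have \<mu>0: "\<mu> x \<ge> 0" for x
    using \<mu> unfolding S_iff by (cases "x \<in> A") (metis order_refl)+
  have J_upd: "J (\<mu>(z := \<mu> z + t)) = J \<mu> + t * (2 * (1 - V \<mu> z) - t * K z z)" if z: "z \<in> A" for z t
  proof -
    let ?d = "\<lambda>x. if x = z then t else 0"
    have upd: "\<mu>(z := \<mu> z + t) = (\<lambda>x. \<mu> x + ?d x)"
      by auto
    have Vd: "V (\<lambda>x. \<mu> x + ?d x) x = V \<mu> x + t * K x z" for x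
    proof -
      have "(\<Sum>y\<in>A. K x y * ?d y) = (\<Sum>y\<in>A. if y = z then t * K x z else 0)"
        by (intro sum.cong) auto
      also have "\<dots> = t * K x z"
        using z fin by simp
      finally show ?thesis
        by (simp add: V_def distrib_left sum.distrib)
    qed
    have "(\<Sum>x\<in>A. ?d x * (V \<mu> x + t * K x z)) = (\<Sum>x\<in>A. if x = z then t * (V \<mu> z + t * K z z) else 0)"
      by (intro sum.cong) auto
    then have d: "(\<Sum>x\<in>A. ?d x * (V \<mu> x + t * K x z)) = t * (V \<mu> z + t * K z z)"
      using z fin by simp
    have s: "(\<Sum>x\<in>A. \<mu> x * (t * K x z)) = t * V \<mu> z"
      unfolding V_def sum_distrib_left by (intro sum.cong) (simp_all add: sym[of z])
    have "(\<Sum>x\<in>A. (\<mu> x + ?d x) * (V \<mu> x + t * K x z))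
        = (\<Sum>x\<in>A. \<mu> x * V \<mu> x) + t * V \<mu> z + t * (V \<mu> z + t * K z z)"
      unfolding d[symmetric] s[symmetric] sum.distrib[symmetric]
      by (intro sum.cong) (simp_all add: algebra_simps)
    moreover have "(\<Sum>x\<in>A. \<mu> x + ?d x) = (\<Sum>x\<in>A. \<mu> x) + t"
      using z fin by (simp add: sum.distrib)
    ultimately show ?thesis
      unfolding upd J_def Vd by (simp add: algebra_simps)
  qed
  have Kpos: "K x x > 0" for x
    using diag[of x] by simp
  have low: "V \<mu> z \<ge> 1" if z: "z \<in> A" for z
  proof (rule ccontr)
    assume "\<not> V \<mu> z \<ge> 1"
    then have V: "V \<mu> z < 1" by simp
    have "\<mu> z \<le> K z z * \<mu> z"
      using mult_right_mono[OF diag[of z] \<mu>0[of z]] by simp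
    also have "\<dots> \<le> V \<mu> z"
      unfolding V_def using z fin \<mu>0 nonneg by (intro member_le_sum) simp_all
    finally have "\<mu> z < 1"
      using V by simp
    define t where "t = min 1 ((1 - V \<mu> z) / K z z)"
    have t: "t > 0" "t \<le> 1" "t * K z z \<le> 1 - V \<mu> z"
      using V Kpos[of z] by (auto simp: t_def min_def field_simps)
    have "\<mu>(z := \<mu> z + t) \<in> S"
      using \<mu> z t(1,2) \<mu>0[of z] \<open>\<mu> z < 1\<close> unfolding S_iff by auto
    from max[OF this] have "t * (2 * (1 - V \<mu> z) - t * K z z) \<le> 0"
      unfolding J_upd[OF z] by simp
    moreover have "0 < t * (2 * (1 - V \<mu> z) - t * K z z)"
      using t V by (intro mult_pos_pos) argo+
    ultimately show False by simp
  qed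
  have high: "V \<mu> z = 1" if z: "z \<in> A" and pos: "\<mu> z > 0" for z
  proof (rule ccontr)
    assume "V \<mu> z \<noteq> 1"
    with low[OF z] have V: "V \<mu> z > 1" by simp
    define s where "s = min (\<mu> z) ((V \<mu> z - 1) / K z z)"
    have s: "s > 0" "s \<le> \<mu> z" "s * K z z \<le> V \<mu> z - 1"
      using V Kpos[of z] pos by (auto simp: s_def min_def field_simps)
    have "\<mu>(z := \<mu> z + - s) \<in> S"
      using \<mu> z s(1,2) unfolding S_iff by (auto dest!: spec[of _ z])
    from max[OF this] have "- s * (2 * (1 - V \<mu> z) - - s * K z z) \<le> 0"
      unfolding J_upd[OF z] by simp
    moreover have "0 < s * (2 * (V \<mu> z - 1) - s * K z z)"
      using s V by (intro mult_pos_pos) argo+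
    ultimately show False by (simp add: algebra_simps)
  qed
  show thesis
    using that[of \<mu>] \<mu>0 low high by (simp add: V_def)
qed

text \<open>The optimality conditions of the capacity problem for \<open>A\<close>, in place of the optimisation problem
itself: integrated against \<open>\<mu>\<close> they equate mass and energy.\<close>

definition equilibrium :: "(vertex \<times> vertex) set \<Rightarrow> (vertex \<times> vertex \<Rightarrow> real) \<Rightarrow> bool" where
  "equilibrium A \<mu> \<longleftrightarrow> (\<forall>x. \<mu> x \<ge> 0) \<and> (\<forall>x\<in>A. pot (copot A \<mu>) x \<ge> 1)
     \<and> (\<forall>x\<in>A. \<mu> x > 0 \<longrightarrow> pot (copot A \<mu>) x = 1)"

lemma pot_copot:
  assumes "finite A"
  shows "pot (copot A \<mu>) x = (\<Sum>y\<in>A. real (card (anc2 x \<inter> anc2 y)) * \<mu> y)"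
proof -
  have "pot (copot A \<mu>) x = (\<Sum>y\<in>A. \<Sum>\<alpha> | \<alpha> \<in> anc2 x \<and> \<alpha> \<in> anc2 y. \<mu> y)"
    unfolding pot_def copot_def by (rule sum.swap_restrict) (simp_all add: assms)
  then show ?thesis
    by (simp add: Int_def)
qed

lemma equilibrium_exists:
  assumes fin: "finite A"
  shows "\<exists>\<mu>. equilibrium A \<mu>"
proof -
  have diag: "real (card (anc2 x \<inter> anc2 x)) \<ge> 1" for x
  proof -
    have "card {x} \<le> card (anc2 x)"
      by (intro card_mono) simp_all
    then show ?thesis by simp
  qed
  obtain \<mu> where "\<And>x. \<mu> x \<ge> 0"
    and "\<And>x. x \<in> A \<Longrightarrow> (\<Sum>y\<in>A. real (card (anc2 x \<inter> anc2 y)) * \<mu> y) \<ge> 1"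
    and "\<And>x. x \<in> A \<Longrightarrow> \<mu> x > 0 \<Longrightarrow> (\<Sum>y\<in>A. real (card (anc2 x \<inter> anc2 y)) * \<mu> y) = 1"
    using complementary_weights_exist[of A "\<lambda>x y. real (card (anc2 x \<inter> anc2 y))"] fin diag
    by (auto simp: Int_commute)
  then have "equilibrium A \<mu>"
    unfolding equilibrium_def pot_copot[OF fin] by blast
  then show ?thesis by blast
qed

lemma equilibrium_energy:
  assumes eq: "equilibrium A \<mu>" and A: "A \<subseteq> bitree N"
  shows "(\<Sum>\<alpha>\<in>bitree N. (copot A \<mu> \<alpha>)\<^sup>2) = (\<Sum>x\<in>A. \<mu> x)"
proof -
  have "(\<Sum>\<alpha>\<in>bitree N. (copot A \<mu> \<alpha>)\<^sup>2) = (\<Sum>x\<in>A. \<mu> x * pot (copot A \<mu>) x)"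
    using sum_mult_copot[OF A, of "copot A \<mu>" \<mu>] by (simp add: power2_eq_square)
  also have "\<dots> = (\<Sum>x\<in>A. \<mu> x)"
  proof (rule sum.cong)
    fix x assume "x \<in> A"
    moreover have "\<mu> x = 0 \<or> \<mu> x > 0"
      using eq by (metis equilibrium_def order_le_less)
    ultimately show "\<mu> x * pot (copot A \<mu>) x = \<mu> x"
      using eq by (auto simp: equilibrium_def)
  qed simp
  finally show ?thesis .
qed

text \<open>The restriction of \<open>\<mu>\<close> to \<open>B\<close> need not be an equilibrium measure of \<open>B\<close>, but restricting only lowers the
potential. So the energy of the restriction is at most its mass, and Cauchy-Schwarz against an admissible
\<open>\<phi>\<close> bounds that mass: equilibrium measures are dominated by capacity on all subsets.\<close>

lemma equilibrium_mass_le: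
  assumes eq: "equilibrium A \<mu>" and A: "A \<subseteq> bitree N" and BA: "B \<subseteq> A"
    and adm: "\<And>x. x \<in> B \<Longrightarrow> pot \<phi> x \<ge> 1"
  shows "(\<Sum>x\<in>B. \<mu> x) \<le> (\<Sum>\<alpha>\<in>bitree N. (\<phi> \<alpha>)\<^sup>2)"
proof -
  have \<mu>: "\<mu> x \<ge> 0" for x
    using eq unfolding equilibrium_def by blast
  have fin: "finite A" and BN: "B \<subseteq> bitree N"
    using A BA finite_bitree finite_subset by blast+
  have sub: "pot (copot B \<mu>) x \<le> pot (copot A \<mu>) x" for x
    unfolding pot_def copot_def
    by (intro sum_mono sum_mono2) (use fin BA \<mu> in auto)
  have "(\<Sum>\<alpha>\<in>bitree N. (copot B \<mu> \<alpha>)\<^sup>2) = (\<Sum>x\<in>B. \<mu> x * pot (copot B \<mu>) x)"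
    using sum_mult_copot[OF BN, of "copot B \<mu>" \<mu>] by (simp add: power2_eq_square)
  also have "\<dots> \<le> (\<Sum>x\<in>B. \<mu> x)"
  proof (rule sum_mono)
    fix x assume "x \<in> B"
    then have x: "x \<in> A" using BA by blast
    show "\<mu> x * pot (copot B \<mu>) x \<le> \<mu> x"
    proof (cases "\<mu> x = 0")
      case False
      then have "\<mu> x > 0" using \<mu>[of x] by simp
      then have "pot (copot B \<mu>) x \<le> 1"
        using eq x sub[of x] by (auto simp: equilibrium_def)
      then show ?thesis
        using \<mu>[of x] by (simp add: mult_left_le)
    qed simp
  qed
  finally have g: "(\<Sum>\<alpha>\<in>bitree N. (copot B \<mu> \<alpha>)\<^sup>2) \<le> (\<Sum>x\<in>B. \<mu> x)" .
  have "(\<Sum>x\<in>B. \<mu> x) \<le> (\<Sum>x\<in>B. \<mu> x * pot \<phi> x)"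
    using adm \<mu> by (intro sum_mono) (metis mult.right_neutral mult_left_mono)
  also have "\<dots> = (\<Sum>\<alpha>\<in>bitree N. \<phi> \<alpha> * copot B \<mu> \<alpha>)"
    by (rule sum_mult_copot[OF BN, symmetric])
  also have "\<dots> \<le> (\<Sum>\<alpha>\<in>bitree N. ((\<phi> \<alpha>)\<^sup>2 + (copot B \<mu> \<alpha>)\<^sup>2) / 2)"
    using sum_squares_bound[of "\<phi> _" "copot B \<mu> _"] by (intro sum_mono) (simp add: field_simps)
  also have "\<dots> = ((\<Sum>\<alpha>\<in>bitree N. (\<phi> \<alpha>)\<^sup>2) + (\<Sum>\<alpha>\<in>bitree N. (copot B \<mu> \<alpha>)\<^sup>2)) / 2"
    by (simp only: sum_divide_distrib[symmetric] sum.distrib)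
  finally show ?thesis
    using g by argo
qed

section \<open>Mutual energy of two equilibrium measures\<close>

lemma le_dyadic_layers:
  fixes v t :: real
  assumes t: "t \<ge> 0" and v: "v \<le> 2 ^ n * t"
  shows "v \<le> t + (\<Sum>i<n. if 2 ^ i * t < v \<and> v \<le> 2 * (2 ^ i * t) then 2 * (2 ^ i * t) else 0)"
  using v
proof (induction n)
  case (Suc n)
  show ?case
  proof (cases "v \<le> 2 ^ n * t")
    case True
    with Suc.IH show ?thesis by simp
  next
    case False
    have "0 \<le> (\<Sum>i<n. if 2 ^ i * t < v \<and> v \<le> 2 * (2 ^ i * t) then 2 * (2 ^ i * t) else 0)"
      using t by (intro sum_nonneg) simp
    with False Suc.prems t show ?thesis by (simp add: mult_ac)
  qed
qed simp

text \<open>Below height \<open>t\<close> the potential of \<open>\<mu>\<close> is bounded by \<open>t\<close>. On the layer at height \<open>\<lambda> = 2\<^sup>i t\<close> its integral is at most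
\<open>2 \<lambda>\<close> times the \<open>\<nu>\<close>-mass of the layer, which is at most \<open>72 \<lambda>\<^sup>-\<^sup>3 \<parallel>I* \<mu>\<parallel>\<^sup>2\<close> because \<open>\<nu>\<close> is an equilibrium measure. The free
parameter \<open>t\<close> plays the role of the exponents in \<open>C (\<Sum> \<nu>)\<^sup>2\<^sup>/\<^sup>3 (\<Sum> \<mu>)\<^sup>1\<^sup>/\<^sup>3\<close>, which is the optimised bound.\<close>

lemma mutual_energy_le:
  assumes eqA: "equilibrium A \<mu>" and A: "A \<subseteq> bitree N"
    and eqB: "equilibrium B \<nu>" and B: "B \<subseteq> bitree N" and t: "t \<ge> 1"
  shows "(\<Sum>x\<in>B. \<nu> x * pot (copot A \<mu>) x) \<le> t * (\<Sum>x\<in>B. \<nu> x) + 192 / t\<^sup>2 * (\<Sum>x\<in>A. \<mu> x)"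
proof -
  define F where "F = pot (copot A \<mu>)"
  define c where "c = (\<Sum>x\<in>A. \<mu> x)"
  define L where "L i = {x \<in> B. 2 ^ i * t < F x \<and> F x \<le> 2 * (2 ^ i * t)}" for i
  have \<mu>: "\<mu> x \<ge> 0" and \<nu>: "\<nu> x \<ge> 0" for x
    using eqA eqB unfolding equilibrium_def by blast+
  have fin: "finite A" "finite B"
    using A B finite_bitree finite_subset by blast+
  have c: "c \<ge> 0"
    unfolding c_def by (simp add: \<mu> sum_nonneg)
  have "\<exists>n. \<forall>x\<in>B. F x \<le> 2 ^ n * t"
  proof -
    obtain n where n: "(\<Sum>x\<in>B. F x) < 2 ^ n"
      using real_arch_pow[of 2] by auto
    have "F x \<le> 2 ^ n * t" if "x \<in> B" for x
    proof -
      have "F x \<le> (\<Sum>x\<in>B. F x)"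
        unfolding F_def using that fin
        by (intro member_le_sum pot_nonneg copot_nonneg \<mu>) simp_all
      also have "\<dots> \<le> 2 ^ n * 1" using n by simp
      also have "\<dots> \<le> 2 ^ n * t" using t by (intro mult_left_mono) simp_all
      finally show ?thesis .
    qed
    then show ?thesis by blast
  qed
  then obtain n where n: "\<And>x. x \<in> B \<Longrightarrow> F x \<le> 2 ^ n * t" by blast
  have layer: "(\<Sum>x\<in>L i. \<nu> x) \<le> 72 / (2 ^ i * t) ^ 3 * c" for i
  proof -
    have l: "2 ^ i * t \<ge> 1"
      using mult_mono[of 1 "2 ^ i" 1 t] t by simp
    obtain \<psi> where "\<And>x. 2 ^ i * t < F x \<Longrightarrow> F x \<le> 2 * (2 ^ i * t) \<Longrightarrow> pot \<psi> x \<ge> 1"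
      and \<psi>: "(\<Sum>\<alpha>\<in>bitree N. (\<psi> \<alpha>)\<^sup>2) \<le> 72 / (2 ^ i * t) ^ 3 * (\<Sum>\<alpha>\<in>bitree N. (copot A \<mu> \<alpha>)\<^sup>2)"
      unfolding F_def
      by (rule level_set_competitor[where X = A and \<mu> = \<mu> and l = "2 ^ i * t" and N = N])
        (use eqA fin l in \<open>auto simp: equilibrium_def\<close>)
    then have "(\<Sum>x\<in>L i. \<nu> x) \<le> (\<Sum>\<alpha>\<in>bitree N. (\<psi> \<alpha>)\<^sup>2)"
      by (intro equilibrium_mass_le[OF eqB B]) (auto simp: L_def)
    with \<psi> show ?thesis
      by (simp add: equilibrium_energy[OF eqA A] c_def)
  qed
  have "(\<Sum>x\<in>B. \<nu> x * F x) \<le> (\<Sum>x\<in>B. \<nu> x * (t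
      + (\<Sum>i<n. if 2 ^ i * t < F x \<and> F x \<le> 2 * (2 ^ i * t) then 2 * (2 ^ i * t) else 0)))"
    using t n \<nu> by (intro sum_mono mult_left_mono le_dyadic_layers) auto
  also have "\<dots> = t * (\<Sum>x\<in>B. \<nu> x)
      + (\<Sum>x\<in>B. \<Sum>i<n. if 2 ^ i * t < F x \<and> F x \<le> 2 * (2 ^ i * t) then 2 * (2 ^ i * t) * \<nu> x else 0)"
    by (simp add: distrib_left sum.distrib sum_distrib_left mult_ac if_distrib cong: if_cong)
  also have "(\<Sum>x\<in>B. \<Sum>i<n. if 2 ^ i * t < F x \<and> F x \<le> 2 * (2 ^ i * t) then 2 * (2 ^ i * t) * \<nu> x else 0)
      = (\<Sum>i<n. \<Sum>x\<in>B. if 2 ^ i * t < F x \<and> F x \<le> 2 * (2 ^ i * t) then 2 * (2 ^ i * t) * \<nu> x else 0)"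
    by (rule sum.swap)
  also have "\<dots> = (\<Sum>i<n. 2 * (2 ^ i * t) * (\<Sum>x\<in>L i. \<nu> x))"
    by (simp add: sum.If_cases fin L_def Int_def sum_distrib_left)
  also have "\<dots> \<le> (\<Sum>i<n. 2 * (2 ^ i * t) * (72 / (2 ^ i * t) ^ 3 * c))"
    using t by (intro sum_mono mult_left_mono layer) simp_all
  also have "\<dots> = (\<Sum>i<n. 144 * c / t\<^sup>2 * (1 / 4) ^ i)"
  proof (rule sum.cong)
    fix i
    have "(4::real) ^ i = 2 ^ i * 2 ^ i"
      by (simp flip: power_mult_distrib)
    then show "2 * (2 ^ i * t) * (72 / (2 ^ i * t) ^ 3 * c) = 144 * c / t\<^sup>2 * (1 / 4) ^ i"
      using t by (simp add: power_divide field_simps eval_nat_numeral)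
  qed simp
  also have "\<dots> = 144 * c / t\<^sup>2 * ((1 - (1 / 4) ^ n) * (4 / 3))"
    unfolding sum_distrib_left[symmetric] by (simp add: sum_gp_strict)
  also have "\<dots> \<le> 144 * c / t\<^sup>2 * (1 * (4 / 3))"
    using c by (intro mult_left_mono mult_right_mono) simp_all
  also have "\<dots> = 192 / t\<^sup>2 * c"
    by simp
  finally show ?thesis
    by (simp add: F_def c_def)
qed

section \<open>The layered inequality at finite depth\<close>

lemma sum_half_dist_le: "(\<Sum>k<n. (1 / 2 :: real) ^ ((j - k) + (k - j))) \<le> 4"
proof -
  let ?h = "\<lambda>k. (1 / 2 :: real) ^ ((j - k) + (k - j))"
  have geo: "(\<Sum>d<m. (1 / 2 :: real) ^ d) \<le> 2" for m
    by (simp add: sum_gp_strict)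
  have "(\<Sum>k<n. ?h k) \<le> (\<Sum>k\<in>{..<Suc j} \<union> {j..<j + n}. ?h k)"
    by (intro sum_mono2) auto
  also have "\<dots> \<le> (\<Sum>k<Suc j. ?h k) + (\<Sum>k\<in>{j..<j + n}. ?h k)"
    by (subst sum_Un) (simp_all add: sum_nonneg)
  also have "(\<Sum>k<Suc j. ?h k) = (\<Sum>k<Suc j. (1 / 2) ^ (j - k))"
    by (intro sum.cong) auto
  also have "\<dots> = (\<Sum>d<Suc j. (1 / 2) ^ d)"
    using sum.nat_diff_reindex[of "\<lambda>d. (1 / 2 :: real) ^ d" "Suc j"] by simp
  also have "(\<Sum>k\<in>{j..<j + n}. ?h k) = (\<Sum>d<n. (1 / 2) ^ d)"
    by (rule sum.reindex_bij_witness[of _ "\<lambda>d. d + j" "\<lambda>k. k - j"]) auto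
  finally show ?thesis
    using geo[of "Suc j"] geo[of n] by simp
qed

text \<open>Hansson's argument. With levels \<open>8\<^sup>j\<close> and the choice \<open>t = 4\<^sup>d\<close> at distance \<open>d\<close> in \<open>mutual_energy_le\<close>, both terms
of that bound decay like \<open>2\<^sup>-\<^sup>d\<close> after normalisation: the first as \<open>4\<^sup>d / 8\<^sup>d\<close>, the second as \<open>8\<^sup>d / 16\<^sup>d\<close>.
The ratio \<open>8\<close> is chosen to keep all exponents integral.\<close>

lemma equilibrium_layers_le:
  fixes a :: "nat \<Rightarrow> real"
  assumes eq: "\<And>j. equilibrium (A j) (\<mu> j)" and A: "\<And>j. A j \<subseteq> bitree N"
    and \<epsilon>: "\<epsilon> > 0" and a: "\<And>j. a j = \<epsilon> * 8 ^ j"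
    and large: "\<And>j x. x \<in> A j \<Longrightarrow> pot \<phi> x \<ge> a j"
  shows "(\<Sum>j<n. (a j)\<^sup>2 * (\<Sum>x\<in>A j. \<mu> j x)) \<le> 1536 * (\<Sum>\<alpha>\<in>bitree N. (\<phi> \<alpha>)\<^sup>2)"
proof -
  define f where "f j = copot (A j) (\<mu> j)" for j
  define c where "c j = (\<Sum>x\<in>A j. \<mu> j x)" for j
  define w where "w j = (a j)\<^sup>2 * c j" for j
  define E where "E j k = (\<Sum>\<alpha>\<in>bitree N. f j \<alpha> * f k \<alpha>)" for j k
  define W where "W = (\<Sum>j<n. w j)"
  define g where "g \<alpha> = (\<Sum>j<n. a j * f j \<alpha>)" for \<alpha>
  have \<mu>: "\<mu> j x \<ge> 0" for j x
    using eq[of j] unfolding equilibrium_def by blast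
  have a_pos: "a j > 0" for j
    using \<epsilon> by (simp add: a)
  have c0: "c j \<ge> 0" for j
    unfolding c_def by (simp add: \<mu> sum_nonneg)
  have w0: "w j \<ge> 0" for j
    by (simp add: w_def c0)
  have E_sym: "E j k = E k j" for j k
    by (simp add: E_def mult.commute)
  have decay: "a (k + d) * a k * E (k + d) k \<le> (1 / 2) ^ d * (192 * (w (k + d) + w k))" for k d
  proof -
    have "E (k + d) k = (\<Sum>x\<in>A (k + d). \<mu> (k + d) x * pot (f k) x)"
      using sum_mult_copot[OF A, of "f k" "k + d" "\<mu> (k + d)"]
      by (simp add: E_def f_def mult.commute)
    also have "\<dots> \<le> 4 ^ d * c (k + d) + 192 / (4 ^ d)\<^sup>2 * c k"
      unfolding f_def c_def by (rule mutual_energy_le[OF eq A eq A]) simp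
    finally have "a (k + d) * a k * E (k + d) k
        \<le> a (k + d) * a k * (4 ^ d * c (k + d) + 192 / (4 ^ d)\<^sup>2 * c k)"
      using a_pos by (intro mult_left_mono) (simp_all add: less_imp_le)
    also have "\<dots> = (1 / 2) ^ d * (w (k + d) + 192 * w k)"
    proof -
      have p: "(8::real) ^ d = 2 ^ d * 2 ^ d * 2 ^ d" "(4::real) ^ d = 2 ^ d * 2 ^ d"
        by (simp_all flip: power_mult_distrib)
      show ?thesis
        by (simp add: w_def a power_add p power_divide field_simps power2_eq_square)
    qed
    also have "\<dots> \<le> (1 / 2) ^ d * (192 * (w (k + d) + w k))"
      using w0 by (intro mult_left_mono) simp_all
    finally show ?thesis .
  qed
  have decay': "a j * a k * E j k \<le> (1 / 2) ^ ((j - k) + (k - j)) * (192 * (w j + w k))" for j k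
  proof (cases "k \<le> j")
    case True
    then show ?thesis
      using decay[of k "j - k"] by simp
  next
    case False
    then show ?thesis
      using decay[of j "k - j"] by (simp add: E_sym[of j] mult_ac add_ac)
  qed
  have sum_decay: "(\<Sum>j<n. \<Sum>k<n. (1 / 2) ^ ((j - k) + (k - j)) * w j) \<le> 4 * W"
  proof -
    have "(\<Sum>j<n. \<Sum>k<n. (1 / 2) ^ ((j - k) + (k - j)) * w j) \<le> (\<Sum>j<n. 4 * w j)"
      unfolding sum_distrib_right[symmetric]
      by (intro sum_mono mult_right_mono sum_half_dist_le w0)
    then show ?thesis
      by (simp add: W_def sum_distrib_left)
  qed
  have "(\<Sum>\<alpha>\<in>bitree N. (g \<alpha>)\<^sup>2)
      = (\<Sum>\<alpha>\<in>bitree N. \<Sum>j<n. \<Sum>k<n. a j * a k * (f j \<alpha> * f k \<alpha>))"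
    by (simp add: g_def power2_eq_square sum_product mult_ac)
  also have "\<dots> = (\<Sum>j<n. \<Sum>\<alpha>\<in>bitree N. \<Sum>k<n. a j * a k * (f j \<alpha> * f k \<alpha>))"
    by (rule sum.swap)
  also have "\<dots> = (\<Sum>j<n. \<Sum>k<n. \<Sum>\<alpha>\<in>bitree N. a j * a k * (f j \<alpha> * f k \<alpha>))"
    by (intro sum.cong refl sum.swap)
  also have "\<dots> = (\<Sum>j<n. \<Sum>k<n. a j * a k * E j k)"
    by (simp add: E_def sum_distrib_left)
  also have "\<dots> \<le> (\<Sum>j<n. \<Sum>k<n. (1 / 2) ^ ((j - k) + (k - j)) * (192 * (w j + w k)))"
    by (intro sum_mono decay')
  also have "\<dots> = 192 * ((\<Sum>j<n. \<Sum>k<n. (1 / 2) ^ ((j - k) + (k - j)) * w j)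
      + (\<Sum>j<n. \<Sum>k<n. (1 / 2) ^ ((j - k) + (k - j)) * w k))"
    by (simp add: sum.distrib sum_distrib_left algebra_simps)
  also have "(\<Sum>j<n. \<Sum>k<n. (1 / 2) ^ ((j - k) + (k - j)) * w k)
      = (\<Sum>j<n. \<Sum>k<n. (1 / 2) ^ ((j - k) + (k - j)) * w j)"
    by (subst sum.swap) (simp add: add.commute)
  finally have g: "(\<Sum>\<alpha>\<in>bitree N. (g \<alpha>)\<^sup>2) \<le> 1536 * W"
    using sum_decay by simp
  have "W \<le> (\<Sum>j<n. \<Sum>\<alpha>\<in>bitree N. a j * (\<phi> \<alpha> * f j \<alpha>))"
    unfolding W_def
  proof (rule sum_mono)
    fix j
    have "a j * c j \<le> (\<Sum>x\<in>A j. \<mu> j x * pot \<phi> x)"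
      unfolding c_def sum_distrib_left
      using mult_left_mono[OF large \<mu>] by (intro sum_mono) (simp add: mult.commute)
    also have "\<dots> = (\<Sum>\<alpha>\<in>bitree N. \<phi> \<alpha> * f j \<alpha>)"
      unfolding f_def by (rule sum_mult_copot[OF A, symmetric])
    finally show "w j \<le> (\<Sum>\<alpha>\<in>bitree N. a j * (\<phi> \<alpha> * f j \<alpha>))"
      using a_pos[of j] by (simp add: w_def power2_eq_square sum_distrib_left[symmetric] mult.assoc)
  qed
  also have "\<dots> = (\<Sum>\<alpha>\<in>bitree N. \<Sum>j<n. a j * (\<phi> \<alpha> * f j \<alpha>))"
    by (rule sum.swap)
  also have "\<dots> = (\<Sum>\<alpha>\<in>bitree N. \<phi> \<alpha> * g \<alpha>)"
    by (simp add: g_def sum_distrib_left mult_ac)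
  \<comment> \<open>The weights are chosen such that, by the bound on \<open>g\<close>, half of \<open>W\<close> can be absorbed.\<close>
  also have "\<dots> \<le> (\<Sum>\<alpha>\<in>bitree N. 768 * (\<phi> \<alpha>)\<^sup>2 + (g \<alpha>)\<^sup>2 / 3072)"
  proof (rule sum_mono)
    fix \<alpha>
    have "0 \<le> (1536 * \<phi> \<alpha> - g \<alpha>)\<^sup>2" by simp
    then show "\<phi> \<alpha> * g \<alpha> \<le> 768 * (\<phi> \<alpha>)\<^sup>2 + (g \<alpha>)\<^sup>2 / 3072"
      by (simp add: power2_eq_square algebra_simps)
  qed
  also have "\<dots> = 768 * (\<Sum>\<alpha>\<in>bitree N. (\<phi> \<alpha>)\<^sup>2) + (\<Sum>\<alpha>\<in>bitree N. (g \<alpha>)\<^sup>2) / 3072"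
    by (simp add: sum.distrib sum_distrib_left sum_divide_distrib)
  finally have "W \<le> 1536 * (\<Sum>\<alpha>\<in>bitree N. (\<phi> \<alpha>)\<^sup>2)"
    using g by simp
  then show ?thesis
    by (simp add: W_def w_def c_def)
qed

section \<open>From boundary points to vertices of finite depth\<close>

text \<open>A function of depth \<open>N\<close> has at a boundary point the same potential as at the vertex where the two rays
have reached level \<open>N\<close>.\<close>

lemma length_ray_vertex [simp]: "length (ray_vertex \<omega> j) = j"
proof (induction j)
  case 0
  show ?case using ray_vertex[of \<omega>] by simp
next
  case (Suc j)
  then show ?case using ray_vertex[of \<omega>] by (auto simp: is_child_def dest: spec[of _ j])
qed

lemma prefix_ray_vertex: "i \<le> j \<Longrightarrow> prefix (ray_vertex \<omega> i) (ray_vertex \<omega> j)"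
proof (induction j rule: dec_induct)
  case (step j)
  obtain b where "ray_vertex \<omega> (Suc j) = ray_vertex \<omega> j @ [b]"
    using ray_vertex[of \<omega>] by (auto simp: is_child_def dest: spec[of _ j])
  with step show ?case by simp
qed simp

lemma anc_ray_vertex: "anc (ray_vertex \<omega> N) = {a \<in> words N. \<exists>j. a = ray_vertex \<omega> j}"
proof (intro equalityI subsetI)
  fix a assume "a \<in> anc (ray_vertex \<omega> N)"
  then have a: "prefix a (ray_vertex \<omega> N)" and len: "length a \<le> N"
    using prefix_length_le[of a "ray_vertex \<omega> N"] by (simp_all add: anc_def)
  have "prefix a (ray_vertex \<omega> (length a)) \<or> prefix (ray_vertex \<omega> (length a)) a"
    using a prefix_ray_vertex[OF len] by (rule prefix_same_cases)
  then have "a = ray_vertex \<omega> (length a)"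
    by (metis append_eq_conv_conj length_ray_vertex order_refl prefix_def take_all)
  with len show "a \<in> {a \<in> words N. \<exists>j. a = ray_vertex \<omega> j}"
    by (auto simp: words_def)
qed (auto simp: anc_def words_def prefix_ray_vertex)

definition ray_node :: "nat \<Rightarrow> ray \<times> ray \<Rightarrow> vertex \<times> vertex" where
  "ray_node N \<omega> = (ray_vertex (fst \<omega>) N, ray_vertex (snd \<omega>) N)"

lemma ray_node_in_bitree [simp]: "ray_node N \<omega> \<in> bitree N"
  by (simp add: ray_node_def bitree_def words_def)

lemma anc2_ray_node:
  "anc2 (ray_node N \<omega>)
     = {\<alpha> \<in> bitree N. bitree_le (map_prod Ray Ray \<omega>) (map_prod Vertex Vertex \<alpha>)}"
  by (cases \<omega>) (auto simp: anc2_def ray_node_def bitree_def anc_ray_vertex bitree_le_def)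

lemma potential_finite_depth:
  assumes nonneg: "\<And>\<alpha>. f \<alpha> \<ge> 0" and supp: "\<And>\<alpha>. \<alpha> \<notin> bitree N \<Longrightarrow> f \<alpha> = 0"
  shows "potential f (map_prod Ray Ray \<omega>) = ennreal (pot f (ray_node N \<omega>))"
proof -
  have "potential f (map_prod Ray Ray \<omega>) = infsum (\<lambda>\<alpha>. ennreal (f \<alpha>)) (anc2 (ray_node N \<omega>))"
    unfolding potential_def anc2_ray_node
    by (rule infsum_cong_neutral) (auto simp: supp)
  then show ?thesis
    by (simp add: pot_def nonneg)
qed

lemma l2_norm_sq_finite_depth:
  assumes supp: "\<And>\<alpha>. \<alpha> \<notin> bitree N \<Longrightarrow> f \<alpha> = 0"
  shows "l2_norm_sq f = ennreal (\<Sum>\<alpha>\<in>bitree N. (f \<alpha>)\<^sup>2)"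
proof -
  have "l2_norm_sq f = infsum (\<lambda>\<alpha>. ennreal ((f \<alpha>)\<^sup>2)) (bitree N)"
    unfolding l2_norm_sq_def by (rule infsum_cong_neutral) (auto simp: supp)
  then show ?thesis by simp
qed

definition superlevel :: "(vertex \<times> vertex \<Rightarrow> real) \<Rightarrow> real \<Rightarrow> (point \<times> point) set" where
  "superlevel \<phi> l = {\<zeta> \<in> boundary \<times> boundary. potential \<phi> \<zeta> > ennreal l}"

lemma boundary2_eq: "boundary \<times> boundary = range (map_prod Ray Ray)"
  by (auto simp: boundary_def image_iff)

lemma Cap_le: "(\<And>\<alpha>. f \<alpha> \<ge> 0) \<Longrightarrow> (\<And>\<zeta>. \<zeta> \<in> E \<Longrightarrow> potential f \<zeta> \<ge> 1) \<Longrightarrow> Cap E \<le> l2_norm_sq f"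
  unfolding Cap_def by (intro Inf_lower) blast

text \<open>The adjoint potential of the equilibrium measure is itself an admissible function, so the capacity of a
superlevel set is at most the equilibrium mass.\<close>

lemma layered_capacity_le_finite_depth:
  assumes \<phi>: "\<And>\<alpha>. \<phi> \<alpha> \<ge> 0" and supp: "\<And>\<alpha>. \<alpha> \<notin> bitree N \<Longrightarrow> \<phi> \<alpha> = 0" and \<epsilon>: "\<epsilon> > 0"
  shows "(\<Sum>j<n. ennreal ((\<epsilon> * 8 ^ j)\<^sup>2) * Cap (superlevel \<phi> (\<epsilon> * 8 ^ j))) \<le> 1536 * l2_norm_sq \<phi>"
proof -
  define a where "a j = \<epsilon> * 8 ^ j" for j :: nat
  define A where "A j = {x \<in> bitree N. pot \<phi> x > a j}" for j
  have fin: "finite (A j)" for j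
    by (simp add: A_def)
  have "\<forall>j. \<exists>\<mu>. equilibrium (A j) \<mu>"
    using fin equilibrium_exists by blast
  then obtain \<mu> where eq: "\<And>j. equilibrium (A j) (\<mu> j)"
    by metis
  have AN: "A j \<subseteq> bitree N" for j
    by (auto simp: A_def)
  have \<mu>: "\<mu> j x \<ge> 0" for j x
    using eq[of j] unfolding equilibrium_def by blast
  define f where "f j = copot (A j) (\<mu> j)" for j
  have f: "f j \<alpha> \<ge> 0" for j \<alpha>
    unfolding f_def by (intro copot_nonneg \<mu>)
  have f_supp: "f j \<alpha> = 0" if "\<alpha> \<notin> bitree N" for j \<alpha>
  proof -
    have "{x. x \<in> A j \<and> \<alpha> \<in> anc2 x} = {}"
      using that anc2_subset_bitree AN by blast
    then show ?thesis
      by (simp only: f_def copot_def sum.empty)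
  qed
  have cap: "Cap (superlevel \<phi> (a j)) \<le> ennreal (\<Sum>x\<in>A j. \<mu> j x)" for j
  proof -
    have "Cap (superlevel \<phi> (a j)) \<le> l2_norm_sq (f j)"
    proof (rule Cap_le)
      fix \<zeta> assume \<zeta>: "\<zeta> \<in> superlevel \<phi> (a j)"
      then have "\<zeta> \<in> range (map_prod Ray Ray)"
        by (simp add: superlevel_def boundary2_eq)
      then obtain \<omega> where \<omega>: "\<zeta> = map_prod Ray Ray \<omega>"
        by (rule rangeE)
      have "ennreal (a j) < ennreal (pot \<phi> (ray_node N \<omega>))"
        using \<zeta> potential_finite_depth[of \<phi> N \<omega>] \<phi> supp by (simp add: superlevel_def \<omega>)
      then have "ray_node N \<omega> \<in> A j"
        using pot_nonneg[of \<phi>] \<phi> \<epsilon> by (simp add: A_def a_def ennreal_less_iff)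
      then have "pot (f j) (ray_node N \<omega>) \<ge> 1"
        using eq[of j] by (simp add: f_def equilibrium_def)
      then show "potential (f j) \<zeta> \<ge> 1"
        using potential_finite_depth[of "f j" N \<omega>] f f_supp by (simp add: \<omega>)
    qed (rule f)
    also have "\<dots> = ennreal (\<Sum>x\<in>A j. \<mu> j x)"
      using l2_norm_sq_finite_depth[of N "f j"] f_supp equilibrium_energy[OF eq AN, of j]
      by (simp add: f_def)
    finally show ?thesis .
  qed
  have "(\<Sum>j<n. ennreal ((a j)\<^sup>2) * Cap (superlevel \<phi> (a j)))
      \<le> (\<Sum>j<n. ennreal ((a j)\<^sup>2) * ennreal (\<Sum>x\<in>A j. \<mu> j x))"
    by (intro sum_mono mult_left_mono cap) simp
  also have "\<dots> = ennreal (\<Sum>j<n. (a j)\<^sup>2 * (\<Sum>x\<in>A j. \<mu> j x))"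
    by (simp add: ennreal_mult[symmetric] sum_nonneg \<mu>)
  also have "\<dots> \<le> ennreal (1536 * (\<Sum>\<alpha>\<in>bitree N. (\<phi> \<alpha>)\<^sup>2))"
    using equilibrium_layers_le[where A = A and \<mu> = \<mu> and a = a and N = N and \<phi> = \<phi> and \<epsilon> = \<epsilon> and n = n]
      eq AN \<epsilon> by (intro ennreal_leI) (auto simp: a_def A_def)
  also have "\<dots> = 1536 * l2_norm_sq \<phi>"
    by (simp add: l2_norm_sq_finite_depth[of N, OF supp] ennreal_mult sum_nonneg)
  finally show ?thesis
    by (simp add: a_def)
qed

section \<open>Countable subadditivity of the capacity\<close>

lemma infsum_ennreal_le:
  fixes f :: "'i \<Rightarrow> ennreal"
  assumes "\<And>F. finite F \<Longrightarrow> F \<subseteq> A \<Longrightarrow> sum f F \<le> c"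
  shows "infsum f A \<le> c"
  by (subst nonneg_infsum_complete) (auto intro: SUP_least assms)

lemma sum_le_infsum_ennreal:
  fixes f :: "'i \<Rightarrow> ennreal"
  assumes "finite F" "F \<subseteq> A"
  shows "sum f F \<le> infsum f A"
proof -
  have "infsum f A = (SUP F\<in>{F. finite F \<and> F \<subseteq> A}. sum f F)"
    by (rule nonneg_infsum_complete) simp
  moreover have "sum f F \<le> (SUP F\<in>{F. finite F \<and> F \<subseteq> A}. sum f F)"
    by (rule SUP_upper) (simp add: assms)
  ultimately show ?thesis by simp
qed

lemma term_le_suminf_ennreal: "f k \<le> (\<Sum>k. f k :: ennreal)"
  using sum_le_suminf[of f "{k}"] by simp

lemma potential_mono:
  assumes "\<And>\<alpha>. f \<alpha> \<le> g \<alpha>"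
  shows "potential f \<zeta> \<le> potential g \<zeta>"
  unfolding potential_def
  by (intro infsum_mono nonneg_summable_on_complete ennreal_leI assms) simp_all

lemma Cap_mono:
  assumes "E \<subseteq> E'"
  shows "Cap E \<le> Cap E'"
  unfolding Cap_def
proof (intro Inf_superset_mono Collect_mono impI)
  fix c
  assume "\<exists>\<phi>. c = l2_norm_sq \<phi> \<and> (\<forall>\<alpha>. 0 \<le> \<phi> \<alpha>) \<and> (\<forall>\<zeta>\<in>E'. 1 \<le> potential \<phi> \<zeta>)"
  then show "\<exists>\<phi>. c = l2_norm_sq \<phi> \<and> (\<forall>\<alpha>. 0 \<le> \<phi> \<alpha>) \<and> (\<forall>\<zeta>\<in>E. 1 \<le> potential \<phi> \<zeta>)"
    using assms by (elim exE) (rule exI, fast)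
qed

lemma Cap_approx:
  assumes "Cap E < c"
  shows "\<exists>\<psi>. (\<forall>\<alpha>. \<psi> \<alpha> \<ge> 0) \<and> (\<forall>\<zeta>\<in>E. potential \<psi> \<zeta> \<ge> 1) \<and> l2_norm_sq \<psi> < c"
proof -
  obtain d where d: "d < c" "d \<in> {l2_norm_sq \<phi> | \<phi>. (\<forall>\<alpha>. \<phi> \<alpha> \<ge> 0) \<and> (\<forall>\<zeta>\<in>E. potential \<phi> \<zeta> \<ge> 1)}"
    using assms unfolding Cap_def Inf_less_iff by (elim bexE)
  then obtain \<psi> where \<psi>: "d = l2_norm_sq \<psi>" "\<forall>\<alpha>. \<psi> \<alpha> \<ge> 0" "\<forall>\<zeta>\<in>E. potential \<psi> \<zeta> \<ge> 1"
    by (elim CollectE exE conjE)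
  have "l2_norm_sq \<psi> < c"
    using d(1) unfolding \<psi>(1) .
  then show ?thesis
    using \<psi>(2,3) by - (rule exI[of _ \<psi>], intro conjI)
qed

text \<open>The function \<open>\<Psi> = (\<Sum> \<psi>\<^sub>k\<^sup>2)\<^sup>1\<^sup>/\<^sup>2\<close> dominates every \<open>\<psi>\<^sub>k\<close>, hence is admissible for the union when \<open>\<psi>\<^sub>k\<close> is admissible
for \<open>E k\<close>, and its squared norm is the sum of the squared norms.\<close>

lemma Cap_UN_le: "Cap (\<Union>k. E k) \<le> (\<Sum>k::nat. Cap (E k))"
proof (rule ennreal_le_epsilon)
  fix \<delta> :: real
  assume fin: "(\<Sum>k. Cap (E k)) < top" and \<delta>: "0 < \<delta>"
  have "\<exists>\<psi>. (\<forall>\<alpha>. \<psi> \<alpha> \<ge> 0) \<and> (\<forall>\<zeta>\<in>E k. potential \<psi> \<zeta> \<ge> 1)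
      \<and> l2_norm_sq \<psi> \<le> Cap (E k) + ennreal (\<delta> / 2 ^ Suc k)" for k
  proof -
    have "Cap (E k) \<le> (\<Sum>k. Cap (E k))"
      by (rule term_le_suminf_ennreal)
    then have "Cap (E k) \<noteq> top"
      using fin by auto
    then have "Cap (E k) < Cap (E k) + ennreal (\<delta> / 2 ^ Suc k)"
      using \<delta> by (simp add: ennreal_add_left_cancel_less flip: top.not_eq_extremum)
    then show ?thesis
      using Cap_approx less_imp_le by metis
  qed
  then obtain \<psi> where \<psi>0: "\<And>k \<alpha>. \<psi> k \<alpha> \<ge> 0"
    and adm: "\<And>k \<zeta>. \<zeta> \<in> E k \<Longrightarrow> potential (\<psi> k) \<zeta> \<ge> 1"
    and norm: "\<And>k. l2_norm_sq (\<psi> k) \<le> Cap (E k) + ennreal (\<delta> / 2 ^ Suc k)"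
    by metis
  define S where "S \<alpha> = (\<Sum>k. ennreal ((\<psi> k \<alpha>)\<^sup>2))" for \<alpha>
  have "(\<Sum>k. ennreal (\<delta> / 2 ^ Suc k)) = ennreal \<delta>"
  proof -
    have "(\<lambda>k. \<delta> * (1 / 2) ^ Suc k) sums (\<delta> * 1)"
      by (intro sums_mult power_half_series)
    then show ?thesis
      using \<delta> by (intro suminf_ennreal_eq) (simp_all add: power_divide)
  qed
  then have total: "(\<Sum>k. l2_norm_sq (\<psi> k)) \<le> (\<Sum>k. Cap (E k)) + ennreal \<delta>"
    using suminf_le[of "\<lambda>k. l2_norm_sq (\<psi> k)" "\<lambda>k. Cap (E k) + ennreal (\<delta> / 2 ^ Suc k)", OF norm]
    by (simp add: suminf_add[symmetric])
  have S_sum: "sum S F \<le> (\<Sum>k. l2_norm_sq (\<psi> k))" if "finite F" for F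
  proof -
    have "sum S F = (\<Sum>k. \<Sum>\<alpha>\<in>F. ennreal ((\<psi> k \<alpha>)\<^sup>2))"
      unfolding S_def by (rule suminf_sum[symmetric]) simp
    also have "\<dots> \<le> (\<Sum>k. l2_norm_sq (\<psi> k))"
      unfolding l2_norm_sq_def using that by (intro suminf_le sum_le_infsum_ennreal) simp_all
    finally show ?thesis .
  qed
  have S_fin: "S \<alpha> < top" for \<alpha>
  proof -
    have "S \<alpha> \<le> (\<Sum>k. Cap (E k)) + ennreal \<delta>"
      using S_sum[of "{\<alpha>}"] total by simp
    also have "\<dots> < top"
      using fin by simp
    finally show ?thesis .
  qed
  define \<Psi> where "\<Psi> \<alpha> = sqrt (enn2real (S \<alpha>))" for \<alpha>
  have le: "\<psi> k \<alpha> \<le> \<Psi> \<alpha>" for k \<alpha>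
  proof -
    have "ennreal ((\<psi> k \<alpha>)\<^sup>2) \<le> S \<alpha>"
      unfolding S_def by (rule term_le_suminf_ennreal)
    then have "enn2real (ennreal ((\<psi> k \<alpha>)\<^sup>2)) \<le> enn2real (S \<alpha>)"
      using S_fin by (rule enn2real_mono)
    then have "(\<psi> k \<alpha>)\<^sup>2 \<le> enn2real (S \<alpha>)"
      by simp
    then show ?thesis
      unfolding \<Psi>_def by (rule real_le_rsqrt)
  qed
  have "Cap (\<Union>k. E k) \<le> l2_norm_sq \<Psi>"
  proof (rule Cap_le)
    fix \<zeta> assume "\<zeta> \<in> (\<Union>k. E k)"
    then obtain k where "\<zeta> \<in> E k" by blast
    then have "1 \<le> potential (\<psi> k) \<zeta>"
      by (rule adm)
    also have "\<dots> \<le> potential \<Psi> \<zeta>"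
      by (intro potential_mono le)
    finally show "1 \<le> potential \<Psi> \<zeta>" .
  qed (simp add: \<Psi>_def)
  also have "\<dots> = infsum S UNIV"
    using S_fin by (simp add: l2_norm_sq_def \<Psi>_def)
  also have "\<dots> \<le> (\<Sum>k. l2_norm_sq (\<psi> k))"
    by (rule infsum_ennreal_le) (rule S_sum)
  finally show "Cap (\<Union>k. E k) \<le> (\<Sum>k. Cap (E k)) + ennreal \<delta>"
    using total by simp
qed

section \<open>Removal of the depth restriction\<close>

lemma bitree_mono: "M \<le> N \<Longrightarrow> bitree M \<subseteq> bitree N"
  by (auto simp: bitree_def words_def)

lemma finite_subset_bitree:
  assumes "finite F"
  shows "\<exists>N\<ge>k. F \<subseteq> bitree N"
  using assms
proof induction
  case (insert x F)
  then obtain N where N: "N \<ge> k" "F \<subseteq> bitree N" by blast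
  let ?M = "max N (max (length (fst x)) (length (snd x)))"
  have "x \<in> bitree ?M"
    by (cases x) (auto simp: bitree_def words_def)
  then show ?case
    using N bitree_mono[of N ?M] by (intro exI[of _ ?M]) auto
qed auto

text \<open>Depths \<open>N k\<close> are chosen so that the part of \<open>\<phi>\<close> outside the bi-tree of depth \<open>N k\<close> carries at most the fraction
\<open>16\<^sup>-\<^sup>k\<close> of the squared norm; the piece \<open>\<Phi> k\<close> is the part of \<open>\<phi>\<close> on the vertices that enter at step \<open>k\<close>. The factor
\<open>16\<close> pays for the shift of index, since the piece \<open>k\<close> lies outside depth \<open>N (k - 1)\<close>. Decay faster than
\<open>4\<^sup>-\<^sup>k\<close> is required by the rescaling in \<open>superlevel_subset_UN\<close>.\<close>

lemma finite_depth_decomposition: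
  assumes \<phi>: "\<And>\<alpha>. \<phi> \<alpha> \<ge> 0" and fin: "l2_norm_sq \<phi> < top"
  obtains \<Phi> N where "\<And>k \<alpha>. \<Phi> k \<alpha> \<ge> 0" "\<And>k \<alpha>. \<alpha> \<notin> bitree (N k) \<Longrightarrow> \<Phi> k \<alpha> = 0"
    and "\<And>k. l2_norm_sq (\<Phi> k) \<le> ennreal (16 / 16 ^ k) * l2_norm_sq \<phi>"
    and "\<And>F. finite F \<Longrightarrow> \<exists>K::nat. \<forall>\<alpha>\<in>F. \<phi> \<alpha> = (\<Sum>k<K. \<Phi> k \<alpha>)"
proof -
  define s where "s = enn2real (l2_norm_sq \<phi>)"
  have s: "l2_norm_sq \<phi> = ennreal s" and s0: "s \<ge> 0"
    using fin by (simp_all add: s_def)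
  have part: "(\<Sum>\<alpha>\<in>F. (\<phi> \<alpha>)\<^sup>2) \<le> s" if "finite F" for F
  proof -
    have "ennreal (\<Sum>\<alpha>\<in>F. (\<phi> \<alpha>)\<^sup>2) \<le> l2_norm_sq \<phi>"
      unfolding l2_norm_sq_def using sum_le_infsum_ennreal[OF that, of UNIV "\<lambda>\<alpha>. ennreal ((\<phi> \<alpha>)\<^sup>2)"] by simp
    then show ?thesis
      using s0 by (simp add: s)
  qed
  have "\<exists>N\<ge>k. s - s / 16 ^ k \<le> (\<Sum>\<alpha>\<in>bitree N. (\<phi> \<alpha>)\<^sup>2)" for k :: nat
  proof (cases "s = 0")
    case True
    then show ?thesis by (auto intro!: exI[of _ k] sum_nonneg)
  next
    case False
    then have "s - s / 16 ^ k < s"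
      using s0 by simp
    then have "ennreal (s - s / 16 ^ k) < l2_norm_sq \<phi>"
      using s0 False by (simp add: s ennreal_lessI)
    then obtain F where F: "finite F" "ennreal (s - s / 16 ^ k) < (\<Sum>\<alpha>\<in>F. ennreal ((\<phi> \<alpha>)\<^sup>2))"
      using infsum_ennreal_le[of UNIV "\<lambda>\<alpha>. ennreal ((\<phi> \<alpha>)\<^sup>2)" "ennreal (s - s / 16 ^ k)"]
      unfolding l2_norm_sq_def by (meson linorder_not_le)
    then have "ennreal (s - s / 16 ^ k) < ennreal (\<Sum>\<alpha>\<in>F. (\<phi> \<alpha>)\<^sup>2)"
      by simp
    then have "s - s / 16 ^ k \<le> (\<Sum>\<alpha>\<in>F. (\<phi> \<alpha>)\<^sup>2)"
      using ennreal_leI[of "\<Sum>\<alpha>\<in>F. (\<phi> \<alpha>)\<^sup>2" "s - s / 16 ^ k"] by force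
    moreover obtain N where N: "N \<ge> k" "F \<subseteq> bitree N"
      using finite_subset_bitree[OF F(1)] by blast
    moreover have "(\<Sum>\<alpha>\<in>F. (\<phi> \<alpha>)\<^sup>2) \<le> (\<Sum>\<alpha>\<in>bitree N. (\<phi> \<alpha>)\<^sup>2)"
      using N by (intro sum_mono2) simp_all
    ultimately show ?thesis
      by (intro exI[of _ N]) simp
  qed
  then obtain N where N: "\<And>k. N k \<ge> k"
    and tail: "\<And>k. s - s / 16 ^ k \<le> (\<Sum>\<alpha>\<in>bitree (N k). (\<phi> \<alpha>)\<^sup>2)"
    by metis
  define lev where "lev \<alpha> = (LEAST k. \<alpha> \<in> bitree (N k))" for \<alpha>
  have ex: "\<exists>k. \<alpha> \<in> bitree (N k)" for \<alpha>
  proof -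
    obtain k where "\<alpha> \<in> bitree k"
      using finite_subset_bitree[of "{\<alpha>}"] by auto
    then show ?thesis
      using bitree_mono[OF N] by blast
  qed
  have lev: "\<alpha> \<in> bitree (N (lev \<alpha>))" for \<alpha>
    unfolding lev_def using ex by (rule LeastI_ex)
  define \<Phi> where "\<Phi> k \<alpha> = (if lev \<alpha> = k then \<phi> \<alpha> else 0)" for k \<alpha>
  have supp: "\<Phi> k \<alpha> = 0" if "\<alpha> \<notin> bitree (N k)" for k \<alpha>
    using that lev[of \<alpha>] by (auto simp: \<Phi>_def)
  show thesis
  proof
    show "\<Phi> k \<alpha> \<ge> 0" for k \<alpha>
      by (simp add: \<Phi>_def \<phi>)
    show "\<Phi> k \<alpha> = 0" if "\<alpha> \<notin> bitree (N k)" for k \<alpha>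
      using that by (rule supp)
    show "\<exists>K. \<forall>\<alpha>\<in>F. \<phi> \<alpha> = (\<Sum>k<K. \<Phi> k \<alpha>)" if "finite F" for F
    proof -
      obtain K where "\<forall>\<alpha>\<in>F. lev \<alpha> < K"
        using finite_nat_set_iff_bounded[of "lev ` F"] \<open>finite F\<close> by auto
      then show ?thesis
        by (intro exI[of _ K]) (simp add: \<Phi>_def)
    qed
    show "l2_norm_sq (\<Phi> k) \<le> ennreal (16 / 16 ^ k) * l2_norm_sq \<phi>" for k
    proof -
      let ?B = "{\<alpha> \<in> bitree (N k). lev \<alpha> = k}"
      have eq: "(\<Sum>\<alpha>\<in>bitree (N k). (\<Phi> k \<alpha>)\<^sup>2) = (\<Sum>\<alpha>\<in>?B. (\<phi> \<alpha>)\<^sup>2)"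
        by (simp add: \<Phi>_def if_distrib[of "\<lambda>x. x\<^sup>2"] sum.If_cases Int_def cong: if_cong)
      have "(\<Sum>\<alpha>\<in>?B. (\<phi> \<alpha>)\<^sup>2) \<le> 16 / 16 ^ k * s"
      proof (cases k)
        case 0
        then show ?thesis
          using part[of ?B] s0 by simp
      next
        case (Suc i)
        have "lev \<alpha> \<le> i" if "\<alpha> \<in> bitree (N i)" for \<alpha>
          using that unfolding lev_def by (rule Least_le)
        then have disj: "?B \<inter> bitree (N i) = {}"
          by (fastforce simp: Suc)
        have "(\<Sum>\<alpha>\<in>?B. (\<phi> \<alpha>)\<^sup>2) + (\<Sum>\<alpha>\<in>bitree (N i). (\<phi> \<alpha>)\<^sup>2) \<le> s"
          using part[of "?B \<union> bitree (N i)"] by (simp add: sum.union_disjoint disj)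
        with tail[of i] show ?thesis
          by (simp add: Suc)
      qed
      moreover have "l2_norm_sq (\<Phi> k) = ennreal (\<Sum>\<alpha>\<in>?B. (\<phi> \<alpha>)\<^sup>2)"
        unfolding eq[symmetric] by (rule l2_norm_sq_finite_depth) (rule supp)
      ultimately have "l2_norm_sq (\<Phi> k) \<le> ennreal (16 / 16 ^ k * s)"
        by (simp only: ennreal_leI)
      then show ?thesis
        using s0 by (simp add: s ennreal_mult[symmetric])
    qed
  qed
qed

text \<open>If every piece had potential at most \<open>l / 2\<^sup>k\<^sup>+\<^sup>1\<close>, their sum would have potential at most \<open>l\<close>.\<close>

lemma superlevel_subset_UN:
  assumes \<phi>: "\<And>\<alpha>. \<phi> \<alpha> \<ge> 0" and \<Phi>: "\<And>k \<alpha>. \<Phi> k \<alpha> \<ge> 0"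
    and dec: "\<And>F. finite F \<Longrightarrow> \<exists>K::nat. \<forall>\<alpha>\<in>F. \<phi> \<alpha> = (\<Sum>k<K. \<Phi> k \<alpha>)"
  shows "superlevel \<phi> l \<subseteq> (\<Union>k. superlevel (\<lambda>\<alpha>. 2 ^ Suc k * \<Phi> k \<alpha>) l)"
proof (rule subsetI, rule ccontr)
  fix \<zeta>
  assume \<zeta>: "\<zeta> \<in> superlevel \<phi> l" and "\<zeta> \<notin> (\<Union>k. superlevel (\<lambda>\<alpha>. 2 ^ Suc k * \<Phi> k \<alpha>) l)"
  then have small: "potential (\<lambda>\<alpha>. 2 ^ Suc k * \<Phi> k \<alpha>) \<zeta> \<le> ennreal l" for k
    by (force simp: superlevel_def not_less)
  have "potential \<phi> \<zeta> \<le> ennreal l"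
    unfolding potential_def
  proof (rule infsum_ennreal_le)
    fix F assume F: "finite F" "F \<subseteq> {\<alpha>. bitree_le \<zeta> (map_prod Vertex Vertex \<alpha>)}"
    obtain K where K: "\<And>\<alpha>. \<alpha> \<in> F \<Longrightarrow> \<phi> \<alpha> = (\<Sum>k<K. \<Phi> k \<alpha>)"
      using dec[OF F(1)] by blast
    have "(\<Sum>\<alpha>\<in>F. ennreal (\<phi> \<alpha>)) = (\<Sum>\<alpha>\<in>F. \<Sum>k<K. ennreal (\<Phi> k \<alpha>))"
      using K by (intro sum.cong) (simp_all add: \<Phi>)
    also have "\<dots> = (\<Sum>k<K. \<Sum>\<alpha>\<in>F. ennreal (\<Phi> k \<alpha>))"
      by (rule sum.swap)
    also have "\<dots> \<le> (\<Sum>k<K. ennreal (1 / 2 ^ Suc k) * ennreal l)"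
    proof (rule sum_mono)
      fix k
      have "ennreal (\<Phi> k \<alpha>) = ennreal (1 / 2 ^ Suc k) * ennreal (2 ^ Suc k * \<Phi> k \<alpha>)" for \<alpha>
        using \<Phi> by (simp add: ennreal_mult[symmetric])
      then have "(\<Sum>\<alpha>\<in>F. ennreal (\<Phi> k \<alpha>)) = ennreal (1 / 2 ^ Suc k) * (\<Sum>\<alpha>\<in>F. ennreal (2 ^ Suc k * \<Phi> k \<alpha>))"
        by (simp only: sum_distrib_left)
      also have "\<dots> \<le> ennreal (1 / 2 ^ Suc k) * potential (\<lambda>\<alpha>. 2 ^ Suc k * \<Phi> k \<alpha>) \<zeta>"
        unfolding potential_def by (intro mult_left_mono sum_le_infsum_ennreal F) simp
      also have "\<dots> \<le> ennreal (1 / 2 ^ Suc k) * ennreal l"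
        by (intro mult_left_mono small) simp
      finally show "(\<Sum>\<alpha>\<in>F. ennreal (\<Phi> k \<alpha>)) \<le> ennreal (1 / 2 ^ Suc k) * ennreal l" .
    qed
    also have "\<dots> = ennreal (\<Sum>k<K. 1 / 2 ^ Suc k) * ennreal l"
      by (simp add: sum_distrib_right[symmetric])
    also have "\<dots> \<le> ennreal 1 * ennreal l"
    proof (intro mult_right_mono ennreal_leI)
      have "(\<Sum>k<K. 1 / 2 ^ Suc k :: real) = 1 - 1 / 2 ^ K"
        by (induction K) (simp_all add: field_simps)
      then show "(\<Sum>k<K. 1 / 2 ^ Suc k :: real) \<le> 1"
        by simp
    qed simp
    finally show "(\<Sum>\<alpha>\<in>F. ennreal (\<phi> \<alpha>)) \<le> ennreal l" by simp
  qed
  then have "\<not> ennreal l < potential \<phi> \<zeta>"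
    by (rule leD)
  with \<zeta> show False
    by (simp add: superlevel_def)
qed

text \<open>The inequality at finite depth is applied to the pieces \<open>2\<^sup>k\<^sup>+\<^sup>1 \<Phi> k\<close>; their squared norms are bounded by a
multiple of \<open>4\<^sup>k / 16\<^sup>k\<close>, which is summable.\<close>

lemma layered_capacity_le:
  assumes \<phi>: "\<And>\<alpha>. \<phi> \<alpha> \<ge> 0" and fin: "l2_norm_sq \<phi> < top" and \<epsilon>: "\<epsilon> > 0"
  shows "(\<Sum>j<n. ennreal ((\<epsilon> * 8 ^ j)\<^sup>2) * Cap (superlevel \<phi> (\<epsilon> * 8 ^ j))) \<le> 131072 * l2_norm_sq \<phi>"
proof -
  obtain \<Phi> N where \<Phi>: "\<And>k \<alpha>. \<Phi> k \<alpha> \<ge> 0" and supp: "\<And>k \<alpha>. \<alpha> \<notin> bitree (N k) \<Longrightarrow> \<Phi> k \<alpha> = 0"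
    and norm: "\<And>k. l2_norm_sq (\<Phi> k) \<le> ennreal (16 / 16 ^ k) * l2_norm_sq \<phi>"
    and dec: "\<And>F. finite F \<Longrightarrow> \<exists>K::nat. \<forall>\<alpha>\<in>F. \<phi> \<alpha> = (\<Sum>k<K. \<Phi> k \<alpha>)"
    by (rule finite_depth_decomposition[of \<phi>, OF \<phi> fin]) (rule that)
  define \<Psi> where "\<Psi> k \<alpha> = 2 ^ Suc k * \<Phi> k \<alpha>" for k \<alpha>
  define a where "a j = \<epsilon> * 8 ^ j" for j :: nat
  have cap: "Cap (superlevel \<phi> (a j)) \<le> (\<Sum>k. Cap (superlevel (\<Psi> k) (a j)))" for j
  proof -
    have "superlevel \<phi> (a j) \<subseteq> (\<Union>k. superlevel (\<Psi> k) (a j))"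
      unfolding \<Psi>_def[abs_def] using \<phi> \<Phi> dec by (rule superlevel_subset_UN)
    then show ?thesis
      using Cap_mono Cap_UN_le order_trans by blast
  qed
  have piece: "(\<Sum>j<n. ennreal ((a j)\<^sup>2) * Cap (superlevel (\<Psi> k) (a j)))
      \<le> ennreal (98304 * (1 / 4) ^ k) * l2_norm_sq \<phi>" for k
  proof -
    have "(\<Sum>j<n. ennreal ((a j)\<^sup>2) * Cap (superlevel (\<Psi> k) (a j))) \<le> 1536 * l2_norm_sq (\<Psi> k)"
      unfolding a_def by (rule layered_capacity_le_finite_depth[of _ "N k"]) (simp_all add: \<Psi>_def \<Phi> supp \<epsilon>)
    also have "l2_norm_sq (\<Psi> k) = ennreal (4 ^ Suc k) * l2_norm_sq (\<Phi> k)"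
    proof -
      have p: "(2 ^ Suc k * x)\<^sup>2 = 4 ^ Suc k * x\<^sup>2" for x :: real
        by (simp add: power2_eq_square mult_ac flip: power_mult_distrib)
      have "l2_norm_sq (\<Psi> k) = ennreal (\<Sum>\<alpha>\<in>bitree (N k). (\<Psi> k \<alpha>)\<^sup>2)"
        by (rule l2_norm_sq_finite_depth) (simp add: \<Psi>_def supp)
      also have "(\<Sum>\<alpha>\<in>bitree (N k). (\<Psi> k \<alpha>)\<^sup>2) = 4 ^ Suc k * (\<Sum>\<alpha>\<in>bitree (N k). (\<Phi> k \<alpha>)\<^sup>2)"
        unfolding \<Psi>_def p sum_distrib_left ..
      also have "ennreal \<dots> = ennreal (4 ^ Suc k) * l2_norm_sq (\<Phi> k)"
        using l2_norm_sq_finite_depth[of "N k" "\<Phi> k"] supp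
        by (simp add: ennreal_mult sum_nonneg)
      finally show ?thesis .
    qed
    also have "1536 * (ennreal (4 ^ Suc k) * l2_norm_sq (\<Phi> k))
        \<le> ennreal 1536 * (ennreal (4 ^ Suc k) * (ennreal (16 / 16 ^ k) * l2_norm_sq \<phi>))"
      using norm[of k] by (intro mult_mono) simp_all
    also have "\<dots> = ennreal (1536 * 4 ^ Suc k * (16 / 16 ^ k)) * l2_norm_sq \<phi>"
      by (simp only: mult.assoc[symmetric] ennreal_mult[symmetric]) (subst ennreal_mult[symmetric]; simp)+
    also have "1536 * 4 ^ Suc k * (16 / 16 ^ k) = 98304 * (1 / 4 :: real) ^ k"
    proof -
      have "(16::real) ^ k = 4 ^ k * 4 ^ k"
        by (simp flip: power_mult_distrib)
      then show ?thesis
        by (simp add: power_divide)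
    qed
    finally show ?thesis .
  qed
  have "(\<Sum>j<n. ennreal ((a j)\<^sup>2) * Cap (superlevel \<phi> (a j)))
      \<le> (\<Sum>j<n. \<Sum>k. ennreal ((a j)\<^sup>2) * Cap (superlevel (\<Psi> k) (a j)))"
    unfolding ennreal_suminf_cmult by (intro sum_mono mult_left_mono cap) simp
  also have "\<dots> = (\<Sum>k. \<Sum>j<n. ennreal ((a j)\<^sup>2) * Cap (superlevel (\<Psi> k) (a j)))"
    by (rule suminf_sum[symmetric]) simp
  also have "\<dots> \<le> (\<Sum>k. ennreal (98304 * (1 / 4) ^ k) * l2_norm_sq \<phi>)"
    by (intro suminf_le piece) simp_all
  also have "\<dots> = (\<Sum>k. ennreal (98304 * (1 / 4) ^ k)) * l2_norm_sq \<phi>"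
    by simp
  also have "(\<Sum>k. ennreal (98304 * (1 / 4) ^ k)) = ennreal 131072"
  proof (rule suminf_ennreal_eq)
    have "(\<lambda>k. 98304 * (1 / 4 :: real) ^ k) sums (98304 * (1 / (1 - 1 / 4)))"
      by (intro sums_mult geometric_sums) simp
    then show "(\<lambda>k. 98304 * (1 / 4 :: real) ^ k) sums 131072"
      by simp
  qed simp
  finally show ?thesis
    by (simp add: a_def)
qed

lemma Cap_boundary_le_1:
  assumes "E \<subseteq> boundary \<times> boundary"
  shows "Cap E \<le> 1"
proof -
  define f where "f \<alpha> = (if \<alpha> = ([], []) then 1 else 0 :: real)" for \<alpha> :: "vertex \<times> vertex"
  have root: "bitree 0 = {([], [])}"
    by (auto simp: bitree_def words_def)
  have supp: "f \<alpha> = 0" if "\<alpha> \<notin> bitree 0" for \<alpha>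
    using that by (simp add: root f_def)
  have "Cap E \<le> l2_norm_sq f"
  proof (rule Cap_le)
    fix \<zeta> assume "\<zeta> \<in> E"
    then have "\<zeta> \<in> range (map_prod Ray Ray)"
      using assms unfolding boundary2_eq by blast
    then obtain \<omega> where \<omega>: "\<zeta> = map_prod Ray Ray \<omega>"
      by (rule rangeE)
    have "ray_node 0 \<omega> = ([], [])"
      using ray_node_in_bitree[of 0 \<omega>] unfolding root by simp
    then have "pot f (ray_node 0 \<omega>) = 1"
      by (simp add: pot_def anc2_def f_def)
    then show "1 \<le> potential f \<zeta>"
      using potential_finite_depth[of f 0 \<omega>] supp by (simp add: \<omega> f_def)
  qed (simp add: f_def)
  also have "l2_norm_sq f = 1"
    using l2_norm_sq_finite_depth[of 0 f] supp by (simp add: root f_def)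
  finally show ?thesis .
qed

section \<open>The capacitary strong-type inequality\<close>

text \<open>The integral is compared with the sum over the levels \<open>\<epsilon> 8\<^sup>j\<close>, \<open>j \<ge> 0\<close>. Below \<open>\<epsilon>\<close> the capacity is at most
\<open>1\<close>, which costs \<open>2 \<epsilon>\<^sup>2\<close> and disappears as \<open>\<epsilon> \<rightarrow> 0\<close>. The factor \<open>112 = 2 \<cdot> 8 \<cdot> 7\<close> comes from bounding \<open>2 l\<close> by its value at
the right end of an interval from \<open>a\<close> to \<open>8 a\<close>, of length \<open>7 a\<close>.\<close>

theorem theorem1p5:
  "\<exists>C::real. C > 0 \<and>
     (\<forall>\<phi> :: vertex \<times> vertex \<Rightarrow> real. (\<forall>\<alpha>. \<phi> \<alpha> \<ge> 0) \<longrightarrow>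
        (\<integral>\<^sup>+ l \<in> {0..}. Cap {\<zeta> \<in> boundary \<times> boundary. potential \<phi> \<zeta> > ennreal l} * ennreal (2 * l) \<partial>lborel)
          \<le> ennreal C * l2_norm_sq \<phi>)"
proof (intro exI conjI allI impI)
  show "(0::real) < 112 * 131072" by simp
  fix \<phi> :: "vertex \<times> vertex \<Rightarrow> real"
  assume "\<forall>\<alpha>. \<phi> \<alpha> \<ge> 0"
  then have \<phi>: "\<And>\<alpha>. \<phi> \<alpha> \<ge> 0" by blast
  let ?I = "\<integral>\<^sup>+ l \<in> {0..}. Cap (superlevel \<phi> l) * ennreal (2 * l) \<partial>lborel"
  have bound: "?I \<le> ennreal (2 * \<epsilon>\<^sup>2) + ennreal (112 * 131072) * l2_norm_sq \<phi>"
    if \<epsilon>: "\<epsilon> > 0" and fin: "l2_norm_sq \<phi> < top" for \<epsilon> :: real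
  proof -
    define a where "a j = \<epsilon> * 8 ^ j" for j :: nat
    define c where "c j = Cap (superlevel \<phi> (a j))" for j
    have a: "a j > 0" "a j \<le> a (Suc j)" for j
      using \<epsilon> by (simp_all add: a_def)
    let ?h = "\<lambda>l. ennreal (2 * \<epsilon>) * indicator {0..\<epsilon>} l
        + (\<Sum>j. c j * ennreal (2 * a (Suc j)) * indicator {a j..a (Suc j)} l)"
    have "?I \<le> (\<integral>\<^sup>+ l. ?h l \<partial>lborel)"
    proof (rule nn_integral_mono)
      fix l :: real
      show "Cap (superlevel \<phi> l) * ennreal (2 * l) * indicator {0..} l \<le> ?h l"
      proof (cases "l \<le> \<epsilon>")
        case True
        have "Cap (superlevel \<phi> l) * ennreal (2 * l) \<le> 1 * ennreal (2 * \<epsilon>)"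
          using True by (intro mult_mono Cap_boundary_le_1) (auto simp: superlevel_def intro: ennreal_leI)
        then show ?thesis
          using True by (auto simp: indicator_def intro: add_increasing2)
      next
        case False
        obtain n where "l / \<epsilon> < 8 ^ n"
          using real_arch_pow[of 8 "l / \<epsilon>"] by auto
        then have ex: "l < a n"
          using \<epsilon> by (simp add: a_def field_simps)
        define m where "m = (LEAST n. l < a n)"
        have m: "l < a m"
          unfolding m_def using ex by (rule LeastI)
        have "m \<noteq> 0"
          using m False by (cases m) (simp_all add: a_def)
        then obtain j where j: "m = Suc j"
          using not0_implies_Suc by blast
        have low: "a j \<le> l"
          using not_less_Least[of j "\<lambda>n. l < a n"] j by (simp add: m_def)
        have l: "l \<le> a (Suc j)"
          using m j by simp
        have "superlevel \<phi> l \<subseteq> superlevel \<phi> (a j)"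
          unfolding superlevel_def using ennreal_leI[OF low] by (auto intro: le_less_trans)
        then have "Cap (superlevel \<phi> l) * ennreal (2 * l) \<le> c j * ennreal (2 * a (Suc j))"
          unfolding c_def using l by (intro mult_mono Cap_mono) (auto intro: ennreal_leI)
        also have "\<dots> = (\<Sum>j\<in>{j}. c j * ennreal (2 * a (Suc j)) * indicator {a j..a (Suc j)} l)"
          using low l by simp
        also have "\<dots> \<le> (\<Sum>j. c j * ennreal (2 * a (Suc j)) * indicator {a j..a (Suc j)} l)"
          by (rule sum_le_suminf) simp_all
        finally show ?thesis
          using False \<epsilon> by (simp add: indicator_def)
      qed
    qed
    also have "\<dots> = ennreal (2 * \<epsilon>) * ennreal \<epsilon> + (\<Sum>j. c j * ennreal (2 * a (Suc j)) * ennreal (a (Suc j) - a j))"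
      using \<epsilon> a(2) by (simp add: nn_integral_add nn_integral_suminf nn_integral_cmult_indicator)
    also have "(\<Sum>j. c j * ennreal (2 * a (Suc j)) * ennreal (a (Suc j) - a j))
        = (\<Sum>j. ennreal 112 * (ennreal ((a j)\<^sup>2) * c j))"
    proof (rule suminf_cong)
      fix j
      have "c j * ennreal (2 * a (Suc j)) * ennreal (a (Suc j) - a j)
          = c j * ennreal (2 * a (Suc j) * (a (Suc j) - a j))"
        using a[of j] a[of "Suc j"] by (simp add: ennreal_mult mult.assoc)
      also have "2 * a (Suc j) * (a (Suc j) - a j) = 112 * (a j)\<^sup>2"
        by (simp add: a_def power2_eq_square)
      finally show "c j * ennreal (2 * a (Suc j)) * ennreal (a (Suc j) - a j)
          = ennreal 112 * (ennreal ((a j)\<^sup>2) * c j)"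
        by (simp add: ennreal_mult mult_ac)
    qed
    also have "\<dots> = ennreal 112 * (\<Sum>j. ennreal ((a j)\<^sup>2) * c j)"
      by (rule ennreal_suminf_cmult)
    also have "(\<Sum>j. ennreal ((a j)\<^sup>2) * c j) \<le> 131072 * l2_norm_sq \<phi>"
      unfolding a_def c_def
      by (intro suminf_le_const layered_capacity_le \<phi> fin \<epsilon>) simp
    also have "ennreal 112 * (131072 * l2_norm_sq \<phi>) = ennreal (112 * 131072) * l2_norm_sq \<phi>"
      by (subst ennreal_mult) (simp_all add: mult.assoc)
    also have "ennreal (2 * \<epsilon>) * ennreal \<epsilon> = ennreal (2 * \<epsilon>\<^sup>2)"
      using \<epsilon> by (simp add: ennreal_mult[symmetric] power2_eq_square)
    finally show ?thesis
      by (simp add: mult_left_mono)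
  qed
  have "?I \<le> ennreal (112 * 131072) * l2_norm_sq \<phi>"
  proof (cases "l2_norm_sq \<phi> < top")
    case True
    show ?thesis
    proof (rule ennreal_le_epsilon)
      fix e :: real assume "0 < e"
      then show "?I \<le> ennreal (112 * 131072) * l2_norm_sq \<phi> + ennreal e"
        using bound[of "sqrt (e / 2)"] True by (simp add: add.commute)
    qed
  next
    case False
    then have "l2_norm_sq \<phi> = top"
      unfolding less_top[symmetric] by simp
    then show ?thesis
      by (simp add: ennreal_mult_top)
  qed
  then show "(\<integral>\<^sup>+ l \<in> {0..}. Cap {\<zeta> \<in> boundary \<times> boundary. potential \<phi> \<zeta> > ennreal l} * ennreal (2 * l) \<partial>lborel)
          \<le> ennreal (112 * 131072) * l2_norm_sq \<phi>"
    by (simp only: superlevel_def)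
qed

end
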